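(* Let $R$ be a commutative ring, $M$ a finitely generated flat $R$-module, and $J$ an ideal of $R$ which is contained in the Jacobson radical of $R$. If $M/JM$ is a projective $R/J$-module, then $M$ is a projective $R$-module.
   Context: All rings are commutative (with identity). *)

theory Defs
  imports "HOL-Algebra.Module" "HOL-Algebra.QuotRing" "HOL-Algebra.Free_Abelian_Groups"
begin

definition module_span ::
  "('a, 'r) ring_scheme \<Rightarrow> ('a, 'b, 'm) module_scheme \<Rightarrow> 'b set \<Rightarrow> 'b set"
  where "module_span R M S = \<Inter>{H. submodule H R M \<and> S \<subseteq> H}"

definition finitely_generated_module ::
  "('a, 'r) ring_scheme \<Rightarrow> ('a, 'b, 'm) module_scheme \<Rightarrow> bool"
  where "finitely_generated_module R M \<longleftrightarrow>
    (\<exists>S. finite S \<and> S \<subseteq> carrier M \<and> module_span R M S = carrier M)"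

definition module_hom ::
  "('a, 'r) ring_scheme \<Rightarrow> ('a, 'b, 'm) module_scheme \<Rightarrow> ('a, 'c, 'n) module_scheme \<Rightarrow> ('b \<Rightarrow> 'c) set"
  where "module_hom R M N =
    {f \<in> carrier M \<rightarrow> carrier N.
      (\<forall>x\<in>carrier M. \<forall>y\<in>carrier M. f (x \<oplus>\<^bsub>M\<^esub> y) = f x \<oplus>\<^bsub>N\<^esub> f y) \<and>
      (\<forall>a\<in>carrier R. \<forall>x\<in>carrier M. f (a \<odot>\<^bsub>M\<^esub> x) = a \<odot>\<^bsub>N\<^esub> f x)}"

(* The intersection with the carrier only matters for the zero ring, which has no maximal
   ideals; its radical is then the whole ring. *)
definition jacobson_radical :: "('a, 'r) ring_scheme \<Rightarrow> 'a set"
  where "jacobson_radical R = carrier R \<inter> \<Inter>{I. maximalideal I R}"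


definition ideal_smult ::
  "('a, 'r) ring_scheme \<Rightarrow> ('a, 'b, 'm) module_scheme \<Rightarrow> 'a set \<Rightarrow> 'b set"
  where "ideal_smult R M J = module_span R M {a \<odot>\<^bsub>M\<^esub> x |a x. a \<in> J \<and> x \<in> carrier M}"

(* M/JM as a module over R Quot J.  The record fields mult and one inherited from ring carry
   no meaning for modules.  For cosets A = J + a and U = JM + x, the union below is the single
   coset JM + a x. *)
definition quotient_module ::
  "('a, 'r) ring_scheme \<Rightarrow> ('a, 'b, 'm) module_scheme \<Rightarrow> 'a set \<Rightarrow> ('a set, 'b set) module"
  where "quotient_module R M J =
    \<lparr>carrier = a_rcosets\<^bsub>M\<^esub> (ideal_smult R M J), monoid.mult = undefined, monoid.one = undefined,
     ring.zero = ideal_smult R M J, ring.add = set_add M,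
     smult = (\<lambda>A U. \<Union>a\<in>A. \<Union>x\<in>U. ideal_smult R M J +>\<^bsub>M\<^esub> (a \<odot>\<^bsub>M\<^esub> x))\<rparr>"


lemma (in module) module_span_submodule:
  assumes "S \<subseteq> carrier M"
  shows "submodule (module_span R M S) R M"
proof (rule submoduleI)
  have c: "submodule (carrier M) R M \<and> S \<subseteq> carrier M" using assms carrier_is_submodule by auto
  show "module_span R M S \<subseteq> carrier M" using c by (auto simp: module_span_def)
qed (auto simp: module_span_def submodule.smult_closed submoduleE
       dest: submodule.axioms(1)[THEN subgroup.one_closed])

lemma (in module) ideal_smult_submodule:
  assumes "ideal J R"
  shows "submodule (ideal_smult R M J) R M"
  unfolding ideal_smult_def
  using additive_subgroup.a_subset[OF ideal.axioms(1)[OF assms]]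
  by (intro module_span_submodule) auto

lemma (in module) ideal_smult_mem:
  assumes "a \<in> J" "x \<in> carrier M"
  shows "a \<odot>\<^bsub>M\<^esub> x \<in> ideal_smult R M J"
  using assms by (auto simp: ideal_smult_def module_span_def)

lemma (in module) quotient_smult_coset:
  assumes J: "ideal J R" and a: "a \<in> carrier R" and x: "x \<in> carrier M"
  shows "(J +> a) \<odot>\<^bsub>quotient_module R M J\<^esub> (ideal_smult R M J +>\<^bsub>M\<^esub> x)
    = ideal_smult R M J +>\<^bsub>M\<^esub> (a \<odot>\<^bsub>M\<^esub> x)"
proof -
  let ?H = "ideal_smult R M J"
  interpret J: ideal J R by fact
  have sub: "submodule ?H R M" by (rule ideal_smult_submodule[OF J])
  interpret H: abelian_subgroup ?H M
    by (rule abelian_subgroupI3)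
      (use sub in \<open>auto simp: additive_subgroup_def submodule_def M.abelian_group_axioms\<close>)
  have one: "?H +>\<^bsub>M\<^esub> (b \<odot>\<^bsub>M\<^esub> y) = ?H +>\<^bsub>M\<^esub> (a \<odot>\<^bsub>M\<^esub> x)"
    if b: "b \<in> J +> a" and y: "y \<in> ?H +>\<^bsub>M\<^esub> x" for b y
  proof -
    obtain j where j: "j \<in> J" "b = j \<oplus> a" using b by (auto simp: a_r_coset_def')
    obtain h where h: "h \<in> ?H" "y = h \<oplus>\<^bsub>M\<^esub> x" using y by (auto simp: a_r_coset_def')
    have jc: "j \<in> carrier R" and hc: "h \<in> carrier M" using j h H.a_subset J.a_subset by auto
    have "b \<odot>\<^bsub>M\<^esub> y = (j \<odot>\<^bsub>M\<^esub> y \<oplus>\<^bsub>M\<^esub> a \<odot>\<^bsub>M\<^esub> h) \<oplus>\<^bsub>M\<^esub> a \<odot>\<^bsub>M\<^esub> x"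
      using jc hc a x j h by (simp add: smult_l_distr smult_r_distr M.a_assoc M.a_lcomm)
    moreover have "j \<odot>\<^bsub>M\<^esub> y \<oplus>\<^bsub>M\<^esub> a \<odot>\<^bsub>M\<^esub> h \<in> ?H"
      using sub j h hc x a by (intro H.a_closed ideal_smult_mem submodule.smult_closed[OF sub]) auto
    ultimately have "b \<odot>\<^bsub>M\<^esub> y \<in> ?H +>\<^bsub>M\<^esub> (a \<odot>\<^bsub>M\<^esub> x)" by (auto simp: a_r_coset_def')
    then show ?thesis using H.a_repr_independence'[OF _ smult_closed[OF a x]] by simp
  qed
  have "a \<in> J +> a" by (rule J.a_rcos_self[OF a])
  moreover have "x \<in> ?H +>\<^bsub>M\<^esub> x" by (rule H.a_rcos_self[OF x])
  moreover have "(J +> a) \<odot>\<^bsub>quotient_module R M J\<^esub> (?H +>\<^bsub>M\<^esub> x)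
      = (\<Union>b\<in>J +> a. \<Union>y\<in>?H +>\<^bsub>M\<^esub> x. ?H +>\<^bsub>M\<^esub> (b \<odot>\<^bsub>M\<^esub> y))"
    by (simp add: quotient_module_def)
  moreover have "\<dots> = (\<Union>b\<in>J +> a. \<Union>y\<in>?H +>\<^bsub>M\<^esub> x. ?H +>\<^bsub>M\<^esub> (a \<odot>\<^bsub>M\<^esub> x))"
    by (intro SUP_cong refl one)
  ultimately show ?thesis by blast
qed

lemma (in module) quotient_module_is_module:
  assumes J: "ideal J R"
  shows "module (R Quot J) (quotient_module R M J)"
proof -
  let ?H = "ideal_smult R M J" and ?Q = "quotient_module R M J"
  interpret J: ideal J R by fact
  have sub: "submodule ?H R M" by (rule ideal_smult_submodule[OF J])
  interpret H: abelian_subgroup ?H M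
    by (rule abelian_subgroupI3)
      (use sub in \<open>auto simp: additive_subgroup_def submodule_def M.abelian_group_axioms\<close>)
  have Qadd: "(?H +>\<^bsub>M\<^esub> x) \<oplus>\<^bsub>?Q\<^esub> (?H +>\<^bsub>M\<^esub> y) = ?H +>\<^bsub>M\<^esub> (x \<oplus>\<^bsub>M\<^esub> y)"
    if "x \<in> carrier M" "y \<in> carrier M" for x y
    using H.a_rcos_sum that by (simp add: quotient_module_def)
  have Radd: "(J +> a) \<oplus>\<^bsub>R Quot J\<^esub> (J +> b) = J +> (a \<oplus> b)"
    if "a \<in> carrier R" "b \<in> carrier R" for a b
    using J.a_rcos_sum that by (simp add: FactRing_def)
  have Rmult: "(J +> a) \<otimes>\<^bsub>R Quot J\<^esub> (J +> b) = J +> (a \<otimes> b)"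
    if "a \<in> carrier R" "b \<in> carrier R" for a b
    using J.rcoset_mult_add that by (simp add: FactRing_def)
  have Rc: "\<exists>a\<in>carrier R. A = J +> a" if "A \<in> carrier (R Quot J)" for A
    using that by (auto simp: FactRing_def A_RCOSETS_def')
  have Qc: "\<exists>x\<in>carrier M. U = ?H +>\<^bsub>M\<^esub> x" if "U \<in> carrier ?Q" for U
    using that by (auto simp: quotient_module_def A_RCOSETS_def')
  have Qi: "?H +>\<^bsub>M\<^esub> x \<in> carrier ?Q" if "x \<in> carrier M" for x
    using that by (auto simp: quotient_module_def A_RCOSETS_def')
  note s = quotient_smult_coset[OF J]
  show ?thesis
  proof (rule moduleI)
    show "cring (R Quot J)" by (rule J.quotient_is_cring[OF R.is_cring])
    have Qz: "\<zero>\<^bsub>?Q\<^esub> = ?H +>\<^bsub>M\<^esub> \<zero>\<^bsub>M\<^esub>"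
      by (simp add: quotient_module_def M.a_coset_add_zero H.a_subset)
    show "abelian_group ?Q"
    proof (rule abelian_groupI)
      fix U V assume "U \<in> carrier ?Q" "V \<in> carrier ?Q"
      then obtain x y where "x \<in> carrier M" "y \<in> carrier M"
        "U = ?H +>\<^bsub>M\<^esub> x" "V = ?H +>\<^bsub>M\<^esub> y" using Qc by metis
      then show "U \<oplus>\<^bsub>?Q\<^esub> V \<in> carrier ?Q" and "U \<oplus>\<^bsub>?Q\<^esub> V = V \<oplus>\<^bsub>?Q\<^esub> U"
        by (simp_all add: Qadd Qi M.a_comm)
    next
      show "\<zero>\<^bsub>?Q\<^esub> \<in> carrier ?Q" by (simp add: Qz Qi)
    next
      fix U V W assume "U \<in> carrier ?Q" "V \<in> carrier ?Q" "W \<in> carrier ?Q"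
      then obtain x y z where "x \<in> carrier M" "y \<in> carrier M" "z \<in> carrier M"
        "U = ?H +>\<^bsub>M\<^esub> x" "V = ?H +>\<^bsub>M\<^esub> y" "W = ?H +>\<^bsub>M\<^esub> z" using Qc by metis
      then show "U \<oplus>\<^bsub>?Q\<^esub> V \<oplus>\<^bsub>?Q\<^esub> W = U \<oplus>\<^bsub>?Q\<^esub> (V \<oplus>\<^bsub>?Q\<^esub> W)"
        by (simp add: Qadd M.a_assoc)
    next
      fix U assume "U \<in> carrier ?Q"
      then obtain x where x: "x \<in> carrier M" "U = ?H +>\<^bsub>M\<^esub> x" using Qc by metis
      then show "\<zero>\<^bsub>?Q\<^esub> \<oplus>\<^bsub>?Q\<^esub> U = U" by (simp add: Qz Qadd)
      from x have "(?H +>\<^bsub>M\<^esub> (\<ominus>\<^bsub>M\<^esub> x)) \<oplus>\<^bsub>?Q\<^esub> U = \<zero>\<^bsub>?Q\<^esub>"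
        by (simp add: Qz Qadd M.l_neg)
      then show "\<exists>V\<in>carrier ?Q. V \<oplus>\<^bsub>?Q\<^esub> U = \<zero>\<^bsub>?Q\<^esub>"
        using x Qi M.a_inv_closed by blast
    qed
  next
    fix A U assume "A \<in> carrier (R Quot J)" "U \<in> carrier ?Q"
    then show "A \<odot>\<^bsub>?Q\<^esub> U \<in> carrier ?Q" using Rc Qc s Qi by (metis smult_closed)
  next
    fix A B U assume "A \<in> carrier (R Quot J)" "B \<in> carrier (R Quot J)" "U \<in> carrier ?Q"
    then obtain a b x where "a \<in> carrier R" "b \<in> carrier R" "x \<in> carrier M"
      "A = J +> a" "B = J +> b" "U = ?H +>\<^bsub>M\<^esub> x" using Rc Qc by metis
    then show "(A \<oplus>\<^bsub>R Quot J\<^esub> B) \<odot>\<^bsub>?Q\<^esub> U = A \<odot>\<^bsub>?Q\<^esub> U \<oplus>\<^bsub>?Q\<^esub> B \<odot>\<^bsub>?Q\<^esub> U"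
      and "(A \<otimes>\<^bsub>R Quot J\<^esub> B) \<odot>\<^bsub>?Q\<^esub> U = A \<odot>\<^bsub>?Q\<^esub> (B \<odot>\<^bsub>?Q\<^esub> U)"
      by (simp_all add: Radd Rmult s Qadd smult_l_distr smult_assoc1)
  next
    fix A U V assume "A \<in> carrier (R Quot J)" "U \<in> carrier ?Q" "V \<in> carrier ?Q"
    then obtain a x y where "a \<in> carrier R" "x \<in> carrier M" "y \<in> carrier M"
      "A = J +> a" "U = ?H +>\<^bsub>M\<^esub> x" "V = ?H +>\<^bsub>M\<^esub> y" using Rc Qc by metis
    then show "A \<odot>\<^bsub>?Q\<^esub> (U \<oplus>\<^bsub>?Q\<^esub> V) = A \<odot>\<^bsub>?Q\<^esub> U \<oplus>\<^bsub>?Q\<^esub> A \<odot>\<^bsub>?Q\<^esub> V"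
      by (simp add: s Qadd smult_r_distr)
  next
    fix U assume "U \<in> carrier ?Q"
    then obtain x where "x \<in> carrier M" "U = ?H +>\<^bsub>M\<^esub> x" using Qc by metis
    then show "\<one>\<^bsub>R Quot J\<^esub> \<odot>\<^bsub>?Q\<^esub> U = U" by (simp add: FactRing_def s)
  qed
qed


definition tensor_relations ::
  "('a, 'r) ring_scheme \<Rightarrow> ('a, 'b, 'm) module_scheme \<Rightarrow> ('a, 'c, 'n) module_scheme \<Rightarrow>
    ('b \<times> 'c \<Rightarrow>\<^sub>0 int) set"
  where "tensor_relations R N M =
    generate (free_Abelian_group (carrier N \<times> carrier M))
     ({frag_of (x \<oplus>\<^bsub>N\<^esub> x', y) - frag_of (x, y) - frag_of (x', y) |x x' y.
         x \<in> carrier N \<and> x' \<in> carrier N \<and> y \<in> carrier M} \<union>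
      {frag_of (x, y \<oplus>\<^bsub>M\<^esub> y') - frag_of (x, y) - frag_of (x, y') |x y y'.
         x \<in> carrier N \<and> y \<in> carrier M \<and> y' \<in> carrier M} \<union>
      {frag_of (a \<odot>\<^bsub>N\<^esub> x, y) - frag_of (x, a \<odot>\<^bsub>M\<^esub> y) |a x y.
         a \<in> carrier R \<and> x \<in> carrier N \<and> y \<in> carrier M})"

(* The additive group of the tensor product of N and M over R.  Its R-module structure is not
   recorded, as only injectivity of induced maps is used below. *)
definition tensor_group ::
  "('a, 'r) ring_scheme \<Rightarrow> ('a, 'b, 'm) module_scheme \<Rightarrow> ('a, 'c, 'n) module_scheme \<Rightarrow>
    ('b \<times> 'c \<Rightarrow>\<^sub>0 int) set monoid"
  where "tensor_group R N M =
    free_Abelian_group (carrier N \<times> carrier M) Mod tensor_relations R N M"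

(* The map f \<otimes> id from N' \<otimes> M to N \<otimes> M induced by a homomorphism f from N' to N.  All
   representatives c of a coset C contribute the same coset to the union. *)
definition tensor_map ::
  "('a, 'r) ring_scheme \<Rightarrow> ('a, 'b, 'm) module_scheme \<Rightarrow> ('a, 'c, 'n) module_scheme \<Rightarrow>
    ('d \<Rightarrow> 'b) \<Rightarrow> ('d \<times> 'c \<Rightarrow>\<^sub>0 int) set \<Rightarrow> ('b \<times> 'c \<Rightarrow>\<^sub>0 int) set"
  where "tensor_map R N M f C =
    (\<Union>c\<in>C. tensor_relations R N M #>\<^bsub>free_Abelian_group (carrier N \<times> carrier M)\<^esub>
       frag_extend (\<lambda>(x, y). frag_of (f x, y)) c)"

lemma tensor_relations_gens:
  assumes "module R N" "module R M"
  shows "({frag_of (x \<oplus>\<^bsub>N\<^esub> x', y) - frag_of (x, y) - frag_of (x', y) |x x' y.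
         x \<in> carrier N \<and> x' \<in> carrier N \<and> y \<in> carrier M} \<union>
      {frag_of (x, y \<oplus>\<^bsub>M\<^esub> y') - frag_of (x, y) - frag_of (x, y') |x y y'.
         x \<in> carrier N \<and> y \<in> carrier M \<and> y' \<in> carrier M} \<union>
      {frag_of (a \<odot>\<^bsub>N\<^esub> x, y) - frag_of (x, a \<odot>\<^bsub>M\<^esub> y) |a x y.
         a \<in> carrier R \<and> x \<in> carrier N \<and> y \<in> carrier M}) \<subseteq> carrier (free_Abelian_group (carrier N \<times> carrier M))"
  (is "?A \<subseteq> _")
proof -
  interpret N: module R N by fact
  interpret M: module R M by fact
  show ?thesis
    by (auto simp: free_Abelian_group_def dest!: subsetD[OF keys_diff])
qed

lemma tensor_relations_subgroup:
  assumes "module R N" "module R M"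
  shows "subgroup (tensor_relations R N M) (free_Abelian_group (carrier N \<times> carrier M))"
  unfolding tensor_relations_def
  by (rule group.generate_is_subgroup[OF group_free_Abelian_group tensor_relations_gens[OF assms]])


lemma frag_extend_tensor_relations:
  assumes "module R N'" "module R N" "module R M" and f: "f \<in> module_hom R N' N"
    and c: "c \<in> tensor_relations R N' M"
  shows "frag_extend (\<lambda>(x, y). frag_of (f x, y)) c \<in> tensor_relations R N M"
proof -
  let ?G = "free_Abelian_group (carrier N \<times> carrier M)"
  let ?G' = "free_Abelian_group (carrier N' \<times> carrier M)"
  let ?e = "frag_extend (\<lambda>(x, y). frag_of (f x, y))"
  interpret N': module R N' by fact
  interpret N: module R N by fact
  interpret M: module R M by fact
  interpret S: subgroup "tensor_relations R N M" ?G
    by (rule tensor_relations_subgroup) fact+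
  have fc: "f x \<in> carrier N" if "x \<in> carrier N'" for x using f that by (auto simp: module_hom_def)
  have fa: "f (x \<oplus>\<^bsub>N'\<^esub> y) = f x \<oplus>\<^bsub>N\<^esub> f y" if "x \<in> carrier N'" "y \<in> carrier N'" for x y
    using f that by (auto simp: module_hom_def)
  have fs: "f (a \<odot>\<^bsub>N'\<^esub> x) = a \<odot>\<^bsub>N\<^esub> f x" if "x \<in> carrier N'" "a \<in> carrier R" for a x
    using f that by (auto simp: module_hom_def)
  define B where "B =
     ({frag_of (x \<oplus>\<^bsub>N'\<^esub> x', y) - frag_of (x, y) - frag_of (x', y) |x x' y.
         x \<in> carrier N' \<and> x' \<in> carrier N' \<and> y \<in> carrier M} \<union>
      {frag_of (x, y \<oplus>\<^bsub>M\<^esub> y') - frag_of (x, y) - frag_of (x, y') |x y y'.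
         x \<in> carrier N' \<and> y \<in> carrier M \<and> y' \<in> carrier M} \<union>
      {frag_of (a \<odot>\<^bsub>N'\<^esub> x, y) - frag_of (x, a \<odot>\<^bsub>M\<^esub> y) |a x y.
         a \<in> carrier R \<and> x \<in> carrier N' \<and> y \<in> carrier M})"
  have gen: "B \<subseteq> carrier ?G'" unfolding B_def by (rule tensor_relations_gens[OF assms(1,3)])
  have base: "?e h \<in> tensor_relations R N M" if "h \<in> B" for h
    unfolding tensor_relations_def
    by (rule generate.incl)
      (use that in \<open>unfold B_def, elim UnE; clarsimp simp: frag_extend_diff fa fs; use fc in blast\<close>)
  have "c \<in> generate ?G' B" using c unfolding tensor_relations_def B_def .
  then show ?thesis
  proof (induction rule: generate.induct)
    case one then show ?case using S.one_closed by (simp add: free_Abelian_group_def)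
  next
    case (incl h) then show ?case by (rule base)
  next
    case (inv h)
    then have e: "?e h \<in> tensor_relations R N M" by (rule base)
    then have "inv\<^bsub>?G\<^esub> (?e h) \<in> tensor_relations R N M" by (rule S.m_inv_closed)
    moreover have "inv\<^bsub>?G\<^esub> (?e h) = - ?e h"
      using S.mem_carrier[OF e] by simp
    moreover have "inv\<^bsub>?G'\<^esub> h = - h" using gen inv by auto
    ultimately show ?case by (simp add: frag_extend_minus)
  next
    case (eng h1 h2)
    then show ?case using S.m_closed[of "?e h1" "?e h2"] by (simp add: frag_extend_add)
  qed
qed

lemma tensor_map_coset:
  assumes "module R N'" "module R N" "module R M" and f: "f \<in> module_hom R N' N"
    and c: "c \<in> carrier (free_Abelian_group (carrier N' \<times> carrier M))"
  shows "tensor_map R N M f (tensor_relations R N' M #>\<^bsub>free_Abelian_group (carrier N' \<times> carrier M)\<^esub> c)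
    = tensor_relations R N M #>\<^bsub>free_Abelian_group (carrier N \<times> carrier M)\<^esub>
        frag_extend (\<lambda>(x, y). frag_of (f x, y)) c"
proof -
  let ?G = "free_Abelian_group (carrier N \<times> carrier M)"
  let ?G' = "free_Abelian_group (carrier N' \<times> carrier M)"
  let ?S = "tensor_relations R N M" and ?S' = "tensor_relations R N' M"
  let ?e = "frag_extend (\<lambda>(x, y). frag_of (f x, y))"
  have sub: "subgroup ?S ?G" and sub': "subgroup ?S' ?G'"
    by (rule tensor_relations_subgroup; fact)+
  have "Poly_Mapping.keys (frag_of (f x, y)) \<subseteq> carrier N \<times> carrier M"
    if "(x, y) \<in> Poly_Mapping.keys c" for x y
    using c f that by (auto simp: free_Abelian_group_def module_hom_def)
  then have "(\<Union>p\<in>Poly_Mapping.keys c. Poly_Mapping.keys (case p of (x, y) \<Rightarrow> frag_of (f x, y)))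
      \<subseteq> carrier N \<times> carrier M"
    by (intro UN_least) (auto split: prod.splits)
  then have ec: "?e c \<in> carrier ?G"
    using keys_frag_extend[of "\<lambda>(x, y). frag_of (f x, y)" c]
    unfolding carrier_free_Abelian_group_iff by (rule subset_trans[rotated])
  have "?S #>\<^bsub>?G\<^esub> ?e (d + c) = ?S #>\<^bsub>?G\<^esub> ?e c" if d: "d \<in> ?S'" for d
  proof -
    have "?e d \<in> ?S" by (rule frag_extend_tensor_relations) fact+
    then have "?e (d + c) \<in> ?S #>\<^bsub>?G\<^esub> ?e c"
      by (auto simp: frag_extend_add r_coset_def)
    then show ?thesis
      using group.repr_independence[OF group_free_Abelian_group _ ec sub] by metis
  qed
  moreover have "0 \<in> ?S'" using subgroup.one_closed[OF sub'] by simp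
  ultimately show ?thesis unfolding tensor_map_def by (auto simp: r_coset_def)
qed


(* Flatness and projectivity quantify over all R-modules.  HOL cannot quantify over types
   inside a formula, so the types from which the test modules are drawn are parameters.
   Taking larger types makes either property formally stronger.  Both properties reach full
   strength as soon as the types are large enough:
   - flatness, when 'c contains a copy of R, as it suffices to test the inclusions of
     ideals into R;
   - projectivity, when 'c contains the free module on the underlying set of P and 'd
     contains P, as it suffices to split the canonical surjection between the two. *)

definition flat_module ::
  "'c itself \<Rightarrow> ('a, 'r) ring_scheme \<Rightarrow> ('a, 'b, 'm) module_scheme \<Rightarrow> bool"
  where "flat_module _ R M \<longleftrightarrow>
    (\<forall>(N' :: ('a, 'c) module) (N :: ('a, 'c) module) f.
      module R N' \<longrightarrow> module R N \<longrightarrow> f \<in> module_hom R N' N \<longrightarrow> inj_on f (carrier N') \<longrightarrow>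
      inj_on (tensor_map R N M f) (carrier (tensor_group R N' M)))"

definition projective_module ::
  "'c itself \<Rightarrow> 'd itself \<Rightarrow> ('a, 'r) ring_scheme \<Rightarrow> ('a, 'b, 'm) module_scheme \<Rightarrow> bool"
  where "projective_module _ _ R P \<longleftrightarrow>
    (\<forall>(N :: ('a, 'c) module) (N' :: ('a, 'd) module) g f.
      module R N \<longrightarrow> module R N' \<longrightarrow>
      g \<in> module_hom R N N' \<longrightarrow> g ` carrier N = carrier N' \<longrightarrow> f \<in> module_hom R P N' \<longrightarrow>
      (\<exists>h \<in> module_hom R P N. \<forall>x\<in>carrier P. g (h x) = f x))"

end

theory Submission
  imports Defs
begin

text \<open>Present \<open>M\<close> as \<open>F/K\<close> with \<open>F\<close> free on a finite set and \<open>p : F \<rightarrow> M\<close> the projection. By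
  flatness every finite subset of \<open>K\<close> is killed by an endomorphism \<open>a\<close> of \<open>F\<close> over \<open>M\<close>
  (\<open>p a = p\<close>), and projectivity of \<open>M/JM\<close> gives an endomorphism \<open>b\<close> over \<open>M\<close> with
  \<open>b K \<subseteq> J F\<close>. Put \<open>P = (1 - b) F \<subseteq> K\<close>. For \<open>k \<in> K\<close> choose \<open>a\<close> killing \<open>k\<close> and the finitely
  generated \<open>P\<close>. Then \<open>f = b - a\<close> preserves \<open>P\<close>, fixes \<open>k\<close> modulo \<open>P\<close>, and \<open>f\<^sup>2 F \<subseteq> J F\<close>; a
  Nakayama argument over \<open>R[f\<^sup>2]\<close> forces \<open>k \<in> P\<close>. Hence \<open>K = P\<close> is finitely generated, so a
  single \<open>a\<close> over \<open>M\<close> kills all of \<open>K\<close>, and \<open>M\<close> is a direct summand of \<open>F\<close>.\<close>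

subsection \<open>Module homomorphisms\<close>

text \<open>The obstacle is that \<open>K\<close> is not known to be finitely generated. Writing
  \<open>k = (1 - b) k + b k\<close> shows at once that \<open>K = P + (K \<inter> J F)\<close>, but
  Nakayama's lemma cannot be applied to \<open>K/P\<close> over \<open>R\<close>, and flatness kills
  only finitely many relations at a time. The finiteness at hand is that of \<open>F\<close>, so
  each \<open>k\<close> is treated alone, by an endomorphism of \<open>F\<close> that fixes
  \<open>k\<close> modulo \<open>P\<close> and maps all of \<open>F\<close> into \<open>J F\<close>.
  Neither map over \<open>M\<close> does this by itself: \<open>b\<close> is small only on
  \<open>K\<close>, and \<open>a\<close> is controlled only on the elements chosen to be killed. But
  two maps over \<open>M\<close> differ by a map into \<open>K\<close>, and on \<open>K\<close> the
  map \<open>b\<close> takes values in \<open>J F\<close>; this is why \<open>f = b - a\<close>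
  appears and why it is squared. That \<open>a\<close> kills \<open>P\<close> means
  \<open>a b = a\<close>, which makes \<open>f\<close> agree with \<open>b\<close> on
  \<open>P\<close> and lets \<open>a\<close> be compared with \<open>b\<close> on the image of
  \<open>f\<close>. In \<open>F/P\<close> the class of \<open>k\<close> is then an eigenvector of
  \<open>f^2\<close> for the eigenvalue 1, so that \<open>R[f^2]\<close> acts on it through scalars
  of \<open>R\<close>, and a polynomial that annihilates \<open>F/P\<close> becomes a scalar
  \<open>1 - j\<close> annihilating \<open>k\<close> modulo \<open>P\<close>.\<close>

lemma module_homI:
  assumes "\<And>x. x \<in> carrier M \<Longrightarrow> f x \<in> carrier N"
    and "\<And>x y. x \<in> carrier M \<Longrightarrow> y \<in> carrier M \<Longrightarrow> f (x \<oplus>\<^bsub>M\<^esub> y) = f x \<oplus>\<^bsub>N\<^esub> f y"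
    and "\<And>a x. a \<in> carrier R \<Longrightarrow> x \<in> carrier M \<Longrightarrow> f (a \<odot>\<^bsub>M\<^esub> x) = a \<odot>\<^bsub>N\<^esub> f x"
  shows "f \<in> module_hom R M N"
  using assms by (auto simp: module_hom_def)

lemma module_hom_closed:
  "f \<in> module_hom R M N \<Longrightarrow> x \<in> carrier M \<Longrightarrow> f x \<in> carrier N"
  by (auto simp: module_hom_def)

lemma module_hom_add:
  "f \<in> module_hom R M N \<Longrightarrow> x \<in> carrier M \<Longrightarrow> y \<in> carrier M \<Longrightarrow>
    f (x \<oplus>\<^bsub>M\<^esub> y) = f x \<oplus>\<^bsub>N\<^esub> f y"
  by (auto simp: module_hom_def)

lemma module_hom_smult:
  "f \<in> module_hom R M N \<Longrightarrow> a \<in> carrier R \<Longrightarrow> x \<in> carrier M \<Longrightarrow>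
    f (a \<odot>\<^bsub>M\<^esub> x) = a \<odot>\<^bsub>N\<^esub> f x"
  by (auto simp: module_hom_def)

lemma module_hom_zero:
  assumes "module R M" "module R N" "f \<in> module_hom R M N"
  shows "f \<zero>\<^bsub>M\<^esub> = \<zero>\<^bsub>N\<^esub>"
proof -
  interpret M: module R M by fact
  interpret N: module R N by fact
  have "f (\<zero>\<^bsub>R\<^esub> \<odot>\<^bsub>M\<^esub> \<zero>\<^bsub>M\<^esub>) = \<zero>\<^bsub>R\<^esub> \<odot>\<^bsub>N\<^esub> f \<zero>\<^bsub>M\<^esub>"
    using assms(3) by (intro module_hom_smult) auto
  then show ?thesis using module_hom_closed[OF assms(3), of "\<zero>\<^bsub>M\<^esub>"] by simp
qed

lemma module_hom_a_inv:
  assumes "module R M" "module R N" "f \<in> module_hom R M N" "x \<in> carrier M"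
  shows "f (\<ominus>\<^bsub>M\<^esub> x) = \<ominus>\<^bsub>N\<^esub> f x"
proof -
  interpret M: module R M by fact
  interpret N: module R N by fact
  have "f (\<ominus>\<^bsub>R\<^esub> \<one>\<^bsub>R\<^esub> \<odot>\<^bsub>M\<^esub> x) = \<ominus>\<^bsub>R\<^esub> \<one>\<^bsub>R\<^esub> \<odot>\<^bsub>N\<^esub> f x"
    using assms(3,4) by (intro module_hom_smult) auto
  then show ?thesis
    using assms(4) module_hom_closed[OF assms(3,4)] by (simp add: M.smult_l_minus N.smult_l_minus)
qed

lemma module_hom_diff:
  assumes "module R M" "module R N" "f \<in> module_hom R M N" "x \<in> carrier M" "y \<in> carrier M"
  shows "f (x \<ominus>\<^bsub>M\<^esub> y) = f x \<ominus>\<^bsub>N\<^esub> f y"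
proof -
  interpret M: module R M by fact
  show ?thesis using assms unfolding a_minus_def
    by (simp add: module_hom_add module_hom_a_inv)
qed

lemma module_hom_finsum:
  assumes "module R M" "module R N" "f \<in> module_hom R M N" "g \<in> A \<rightarrow> carrier M"
  shows "f (\<Oplus>\<^bsub>M\<^esub>i\<in>A. g i) = (\<Oplus>\<^bsub>N\<^esub>i\<in>A. f (g i))"
  using assms(4)
proof (induction A rule: infinite_finite_induct)
  case (infinite A)
  interpret M: module R M by fact
  interpret N: module R N by fact
  show ?case using infinite assms module_hom_zero by simp
next
  case empty
  interpret M: module R M by fact
  interpret N: module R N by fact
  show ?case using assms module_hom_zero by simp
next
  case (insert i A)
  interpret M: module R M by fact
  interpret N: module R N by fact
  have "(\<lambda>i. f (g i)) \<in> A \<rightarrow> carrier N" using insert.prems module_hom_closed[OF assms(3)] by auto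
  then show ?case using insert assms(3) by (simp add: module_hom_add module_hom_closed Pi_def)
qed

lemma module_hom_ident: "(\<lambda>x. x) \<in> module_hom R M M"
  by (simp add: module_hom_def)

lemma module_hom_comp:
  "f \<in> module_hom R M N \<Longrightarrow> g \<in> module_hom R N L \<Longrightarrow> (\<lambda>x. g (f x)) \<in> module_hom R M L"
  by (auto simp: module_hom_def Pi_def)

lemma module_hom_plus:
  assumes "module R N" "f \<in> module_hom R M N" "g \<in> module_hom R M N"
  shows "(\<lambda>x. f x \<oplus>\<^bsub>N\<^esub> g x) \<in> module_hom R M N"
proof -
  interpret N: module R N by fact
  show ?thesis
    by (rule module_homI)
      (use assms(2,3) in \<open>simp_all add: module_hom_closed module_hom_add module_hom_smult
        N.smult_r_distr N.a_ac\<close>)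
qed

lemma module_hom_scale:
  assumes "module R N" "f \<in> module_hom R M N" "a \<in> carrier R"
  shows "(\<lambda>x. a \<odot>\<^bsub>N\<^esub> f x) \<in> module_hom R M N"
proof -
  interpret N: module R N by fact
  show ?thesis
    by (rule module_homI)
      (use assms(2,3) in \<open>simp_all add: module_hom_closed module_hom_add module_hom_smult
        N.smult_r_distr N.smult_assoc1[symmetric] N.m_comm\<close>)
qed

lemma module_hom_minus:
  assumes "module R N" "f \<in> module_hom R M N" "g \<in> module_hom R M N"
  shows "(\<lambda>x. f x \<ominus>\<^bsub>N\<^esub> g x) \<in> module_hom R M N"
proof -
  interpret N: module R N by fact
  show ?thesis
    by (rule module_homI)
      (use assms(2,3) in \<open>simp_all add: module_hom_closed module_hom_add module_hom_smult a_minus_def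
        N.smult_r_distr N.smult_r_minus N.minus_add N.a_ac\<close>)
qed

subsection \<open>Maximal ideals and a Nakayama argument\<close>

lemma (in cring) ex_maximalideal_containing:
  assumes I: "ideal I R" and proper: "\<one> \<notin> I"
  obtains m where "maximalideal m R" "I \<subseteq> m"
proof -
  define A where "A = {K. ideal K R \<and> I \<subseteq> K \<and> \<one> \<notin> K}"
  have "\<exists>m\<in>A. \<forall>X\<in>A. m \<subseteq> X \<longrightarrow> X = m"
  proof (rule subset_Zorn_nonempty)
    show "A \<noteq> {}" using assms by (auto simp: A_def)
  next
    fix C assume ne: "C \<noteq> {}" and ch: "subset.chain A C"
    have CA: "\<And>K. K \<in> C \<Longrightarrow> ideal K R \<and> I \<subseteq> K \<and> \<one> \<notin> K"
      using ch by (auto simp: subset.chain_def A_def)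
    have add: "additive_subgroup K R" if "K \<in> C" for K using CA that ideal.axioms(1) by blast
    have "ideal (\<Union>C) R"
    proof (rule idealI[OF ring_axioms])
      show "subgroup (\<Union>C) (add_monoid R)"
      proof (rule add.subgroupI)
        show "\<Union>C \<subseteq> carrier R" using additive_subgroup.a_subset[OF add] by blast
        show "\<Union>C \<noteq> {}" using additive_subgroup.zero_closed[OF add] ne by blast
        show "\<ominus> x \<in> \<Union>C" if "x \<in> \<Union>C" for x
          using that subgroup.m_inv_closed[OF additive_subgroup.a_subgroup[OF add]]
          unfolding a_inv_def by blast
        show "x \<oplus> y \<in> \<Union>C" if "x \<in> \<Union>C" "y \<in> \<Union>C" for x y
        proof -
          obtain K L where KL: "K \<in> C" "L \<in> C" "x \<in> K" "y \<in> L"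
            using \<open>x \<in> \<Union>C\<close> \<open>y \<in> \<Union>C\<close> by blast
          then have "K \<subseteq> L \<or> L \<subseteq> K" using ch by (auto simp: subset_chain_def)
          then consider "x \<in> L" | "y \<in> K" using KL by blast
          then have "x \<oplus> y \<in> K \<or> x \<oplus> y \<in> L"
            using additive_subgroup.a_closed[OF add] KL by cases blast+
          then show ?thesis using KL by auto
        qed
      qed
    qed (use CA in \<open>blast dest: ideal.I_l_closed ideal.I_r_closed\<close>)+
    then show "\<Union>C \<in> A" using CA ne by (auto simp: A_def)
  qed
  then obtain m where m: "ideal m R" "I \<subseteq> m" "\<one> \<notin> m"
    and max: "\<And>X. ideal X R \<Longrightarrow> I \<subseteq> X \<Longrightarrow> \<one> \<notin> X \<Longrightarrow> m \<subseteq> X \<Longrightarrow> X = m"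
    by (auto simp: A_def)
  have "maximalideal m R"
  proof (rule maximalidealI[OF m(1)])
    show "carrier R \<noteq> m" using m(3) one_closed by metis
    fix X assume X: "ideal X R" "m \<subseteq> X" "X \<subseteq> carrier R"
    show "X = m \<or> X = carrier R"
    proof (cases "\<one> \<in> X")
      case True then show ?thesis using ideal.one_imp_carrier[OF X(1)] by simp
    next
      case False then show ?thesis using max X m(2) by blast
    qed
  qed
  then show ?thesis using that m(2) by blast
qed

text \<open>A non-unit generates a proper ideal, which lies in some maximal ideal; that ideal would
  contain both \<open>1 - j\<close> and \<open>j\<close>, hence \<open>1\<close>.\<close>

lemma (in cring) one_minus_jacobson_radical_Units:
  assumes j: "j \<in> jacobson_radical R"
  shows "\<one> \<ominus> j \<in> Units R"
proof (rule ccontr)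
  have jR: "j \<in> carrier R" using j by (simp add: jacobson_radical_def)
  then have uR: "\<one> \<ominus> j \<in> carrier R" by simp
  assume "\<one> \<ominus> j \<notin> Units R"
  then have "\<one> \<notin> PIdl (\<one> \<ominus> j)"
    using uR by (auto simp: cgenideal_def Units_def) (metis m_comm)
  then obtain m where m: "maximalideal m R" "PIdl (\<one> \<ominus> j) \<subseteq> m"
    using ex_maximalideal_containing cgenideal_ideal[OF uR] by metis
  interpret m: maximalideal m R by fact
  have "j \<in> m" using j m(1) by (auto simp: jacobson_radical_def)
  moreover have "\<one> \<ominus> j \<in> m" using m(2) cgenideal_self[OF uR] by blast
  ultimately have "(\<one> \<ominus> j) \<oplus> j \<in> m" by (rule m.a_closed[rotated])
  moreover have "(\<one> \<ominus> j) \<oplus> j = \<one>" using jR by (simp add: minus_eq a_assoc l_neg)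
  ultimately show False using m.one_imp_carrier m.I_notcarr by simp
qed

text \<open>This is \<open>R[\<phi>]\<close>, represented by the maps that polynomials induce and
  not by formal polynomials: stability, linearity and commutation all follow by rule induction, and
  no evaluation homomorphism has to be set up. Constants arise by scaling the identity.\<close>

inductive_set endo_polys ::
  "('a, 'r) ring_scheme \<Rightarrow> ('a, 'b, 'm) module_scheme \<Rightarrow> ('b \<Rightarrow> 'b) \<Rightarrow> ('b \<Rightarrow> 'b) set"
  for R F \<phi>
  where
    ident: "(\<lambda>x. x) \<in> endo_polys R F \<phi>"
  | base: "\<phi> \<in> endo_polys R F \<phi>"
  | comp: "f \<in> endo_polys R F \<phi> \<Longrightarrow> g \<in> endo_polys R F \<phi> \<Longrightarrow> (\<lambda>x. f (g x)) \<in> endo_polys R F \<phi>"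
  | plus: "f \<in> endo_polys R F \<phi> \<Longrightarrow> g \<in> endo_polys R F \<phi> \<Longrightarrow>
      (\<lambda>x. f x \<oplus>\<^bsub>F\<^esub> g x) \<in> endo_polys R F \<phi>"
  | scale: "a \<in> carrier R \<Longrightarrow> f \<in> endo_polys R F \<phi> \<Longrightarrow> (\<lambda>x. a \<odot>\<^bsub>F\<^esub> f x) \<in> endo_polys R F \<phi>"

context module
begin

lemma endo_polys_hom:
  assumes "\<phi> \<in> module_hom R M M" "f \<in> endo_polys R M \<phi>"
  shows "f \<in> module_hom R M M"
  using assms(2)
  by induction
    (use assms(1) module_axioms in \<open>auto intro: module_hom_ident module_hom_comp module_hom_plus module_hom_scale\<close>)

lemma endo_polys_stable:
  assumes P: "submodule P R M" "\<And>x. x \<in> P \<Longrightarrow> \<phi> x \<in> P" and "f \<in> endo_polys R M \<phi>" "x \<in> P"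
  shows "f x \<in> P"
  using assms(3,4)
  by (induction arbitrary: x) (auto intro: P(2) submoduleE(4,5)[OF P(1)])

text \<open>An arbitrary \<open>h\<close> is allowed so that the induction can serve twice: with
  \<open>h = \<phi>\<close> it shows that polynomials commute with \<open>\<phi>\<close>, which is
  then the premise for taking \<open>h\<close> to be a polynomial itself.\<close>

lemma endo_polys_commute_aux:
  assumes \<phi>: "\<phi> \<in> module_hom R M M" and h: "h \<in> module_hom R M M"
    and c: "\<And>x. x \<in> carrier M \<Longrightarrow> h (\<phi> x) = \<phi> (h x)"
    and f: "f \<in> endo_polys R M \<phi>" and "x \<in> carrier M"
  shows "h (f x) = f (h x)"
  using f \<open>x \<in> carrier M\<close>
proof (induction arbitrary: x)
  case (plus f g)
  then show ?case using endo_polys_hom[OF \<phi> plus.hyps(1)] endo_polys_hom[OF \<phi> plus.hyps(2)] h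
    by (simp add: module_hom_add module_hom_closed)
next
  case (scale a f)
  then show ?case using endo_polys_hom[OF \<phi> scale.hyps(2)] h
    by (simp add: module_hom_smult module_hom_closed)
next
  case (comp f g)
  then show ?case using module_hom_closed[OF endo_polys_hom[OF \<phi> comp.hyps(2)]] by simp
qed (use c in auto)

lemma endo_polys_commute:
  assumes \<phi>: "\<phi> \<in> module_hom R M M" and f: "f \<in> endo_polys R M \<phi>" and g: "g \<in> endo_polys R M \<phi>"
    and "x \<in> carrier M"
  shows "f (g x) = g (f x)"
proof (rule endo_polys_commute_aux[OF \<phi> endo_polys_hom[OF \<phi> f] _ g \<open>x \<in> carrier M\<close>])
  fix y assume y: "y \<in> carrier M"
  show "f (\<phi> y) = \<phi> (f y)"
    using endo_polys_commute_aux[OF \<phi> \<phi> _ f y] by simp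
qed

text \<open>\<open>C\<close> need not be closed under composition, so that it can be all of
  \<open>R[\<phi>]\<close> as well as the polynomials that act on \<open>k\<close> by a scalar in
  \<open>J\<close>; the Nakayama argument needs \<open>Q + C e\<close> for both.\<close>

lemma submodule_plus_orbit:
  assumes Q: "submodule Q R M" and e: "e \<in> carrier M" and C: "C \<subseteq> module_hom R M M" "C \<noteq> {}"
    and plus: "\<And>f g. f \<in> C \<Longrightarrow> g \<in> C \<Longrightarrow> (\<lambda>x. f x \<oplus>\<^bsub>M\<^esub> g x) \<in> C"
    and scale: "\<And>a f. a \<in> carrier R \<Longrightarrow> f \<in> C \<Longrightarrow> (\<lambda>x. a \<odot>\<^bsub>M\<^esub> f x) \<in> C"
  shows "submodule {q \<oplus>\<^bsub>M\<^esub> s e |q s. q \<in> Q \<and> s \<in> C} R M" (is "submodule ?H R M")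
proof -
  have Qc: "q \<in> carrier M" if "q \<in> Q" for q using submoduleE(1)[OF Q] that by auto
  have sc: "s e \<in> carrier M" if "s \<in> C" for s using C(1) that e by (auto intro: module_hom_closed)
  have I: "h \<in> ?H" if "h = q \<oplus>\<^bsub>M\<^esub> s e" "q \<in> Q" "s \<in> C" for h q s using that by blast
  have sm: "a \<odot>\<^bsub>M\<^esub> h \<in> ?H" if a: "a \<in> carrier R" and h: "h \<in> ?H" for a h
  proof -
    obtain q s where "h = q \<oplus>\<^bsub>M\<^esub> s e" "q \<in> Q" "s \<in> C" using h by blast
    then show ?thesis using a Q
      by (intro I[of _ "a \<odot>\<^bsub>M\<^esub> q" "\<lambda>x. a \<odot>\<^bsub>M\<^esub> s x"] scale)
        (auto simp: smult_r_distr Qc sc submoduleE(4))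
  qed
  have sub: "?H \<subseteq> carrier M" using Qc sc by auto
  show ?thesis
  proof (rule submoduleI)
    show "?H \<subseteq> carrier M" by (rule sub)
    obtain q s where "q \<in> Q" "s \<in> C" using C(2) submoduleE(2)[OF Q] by blast
    then have h: "q \<oplus>\<^bsub>M\<^esub> s e \<in> ?H" by blast
    show "\<zero>\<^bsub>M\<^esub> \<in> ?H" using sm[OF R.zero_closed h] smult_l_null sub h by force
    show "\<ominus>\<^bsub>M\<^esub> h \<in> ?H" if "h \<in> ?H" for h
    proof -
      have "\<ominus> \<one> \<odot>\<^bsub>M\<^esub> h \<in> ?H" using sm[of "\<ominus> \<one>" h] that by simp
      moreover have "h \<in> carrier M" using sub that by blast
      ultimately show ?thesis by (simp add: smult_l_minus)
    qed
    show "h \<oplus>\<^bsub>M\<^esub> h' \<in> ?H" if "h \<in> ?H" "h' \<in> ?H" for h h'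
    proof -
      obtain q s q' s' where *: "h = q \<oplus>\<^bsub>M\<^esub> s e" "q \<in> Q" "s \<in> C" "h' = q' \<oplus>\<^bsub>M\<^esub> s' e" "q' \<in> Q" "s' \<in> C"
        using \<open>h \<in> ?H\<close> \<open>h' \<in> ?H\<close> by blast
      then show ?thesis
        by (intro I[of _ "q \<oplus>\<^bsub>M\<^esub> q'" "\<lambda>x. s x \<oplus>\<^bsub>M\<^esub> s' x"] plus)
          (auto simp: Qc sc M.a_ac submoduleE(5)[OF Q])
    qed
  qed (rule sm)
qed

lemma submodule_diff_closed:
  assumes "submodule P R M" "x \<in> P" "y \<in> P"
  shows "x \<ominus>\<^bsub>M\<^esub> y \<in> P"
  using submoduleE(3,5)[OF assms(1)] assms(2,3) by (simp add: a_minus_def)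

lemma submodule_zero_closed:
  assumes "submodule P R M"
  shows "\<zero>\<^bsub>M\<^esub> \<in> P"
  using subgroup.one_closed[OF submodule.axioms(1)[OF assms]] by simp

text \<open>A substitute for the determinant trick. It suffices to find a polynomial
  \<open>t\<close> in \<open>\<phi>\<close> that maps \<open>M\<close> into \<open>P\<close> and
  acts on the class of \<open>k\<close> in \<open>M/P\<close> by a scalar \<open>1 - j\<close> with
  \<open>j\<close> in \<open>J\<close>: then \<open>(1 - j) k\<close> lies in \<open>P\<close> and
  \<open>1 - j\<close> is a unit. Such a \<open>t\<close> is built as a product, one factor for each
  generator of \<open>M\<close>. The scalar of a polynomial is determined only up to the annihilator
  of the class of \<open>k\<close>, hence the relation \<open>ev\<close> in place of a
  function.\<close>

lemma nakayama_fixed_point: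
  assumes \<phi>: "\<phi> \<in> module_hom R M M"
    and J: "ideal J R" "J \<subseteq> jacobson_radical R"
    and \<phi>J: "\<And>x. x \<in> carrier M \<Longrightarrow> \<phi> x \<in> ideal_smult R M J"
    and fin: "finite E" "E \<subseteq> carrier M" "module_span R M E = carrier M"
    and P: "submodule P R M" "\<And>x. x \<in> P \<Longrightarrow> \<phi> x \<in> P"
    and k: "k \<in> carrier M" "k \<ominus>\<^bsub>M\<^esub> \<phi> k \<in> P"
  shows "k \<in> P"
proof -
  let ?S = "endo_polys R M \<phi>"
  interpret J: ideal J R by fact
  note Pm = submoduleE(3,4,5)[OF P(1)]
  have Pc: "x \<in> carrier M" if "x \<in> P" for x using submoduleE(1)[OF P(1)] that by auto
  have hom: "f \<in> module_hom R M M" if "f \<in> ?S" for f using endo_polys_hom[OF \<phi> that] .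
  have cl: "f x \<in> carrier M" if "f \<in> ?S" "x \<in> carrier M" for f x
    using module_hom_closed[OF hom] that by blast
  have Jc: "j \<in> carrier R" if "j \<in> J" for j using that by (rule J.a_Hcarr)
  \<comment> \<open>Since \<open>\<phi>\<close> fixes \<open>k\<close> modulo \<open>P\<close>, every polynomial in \<open>\<phi>\<close> multiplies the class of \<open>k\<close> by a scalar.\<close>
  define ev where "ev f a \<longleftrightarrow> a \<in> carrier R \<and> f k \<ominus>\<^bsub>M\<^esub> a \<odot>\<^bsub>M\<^esub> k \<in> P" for f a
  have ev_ident: "ev (\<lambda>x. x) \<one>"
    using k P(1) by (simp add: ev_def a_minus_def M.r_neg submodule_zero_closed)
  have ev_base: "ev \<phi> \<one>"
  proof -
    have "\<phi> k \<ominus>\<^bsub>M\<^esub> k = \<ominus>\<^bsub>M\<^esub> (k \<ominus>\<^bsub>M\<^esub> \<phi> k)"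
      using k module_hom_closed[OF \<phi>] by (simp add: a_minus_def M.minus_add M.a_ac)
    then show ?thesis using k Pm by (simp add: ev_def)
  qed
  have ev_plus: "ev (\<lambda>x. f x \<oplus>\<^bsub>M\<^esub> g x) (a \<oplus> b)" if "f \<in> ?S" "g \<in> ?S" "ev f a" "ev g b" for f g a b
  proof -
    have "(f k \<oplus>\<^bsub>M\<^esub> g k) \<ominus>\<^bsub>M\<^esub> (a \<oplus> b) \<odot>\<^bsub>M\<^esub> k
        = (f k \<ominus>\<^bsub>M\<^esub> a \<odot>\<^bsub>M\<^esub> k) \<oplus>\<^bsub>M\<^esub> (g k \<ominus>\<^bsub>M\<^esub> b \<odot>\<^bsub>M\<^esub> k)"
      using that k cl by (simp add: ev_def a_minus_def smult_l_distr M.minus_add M.a_ac)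
    then show ?thesis using that Pm(3) by (simp add: ev_def)
  qed
  have ev_scale: "ev (\<lambda>x. c \<odot>\<^bsub>M\<^esub> f x) (c \<otimes> a)" if "f \<in> ?S" "c \<in> carrier R" "ev f a" for f a c
  proof -
    have "c \<odot>\<^bsub>M\<^esub> f k \<ominus>\<^bsub>M\<^esub> (c \<otimes> a) \<odot>\<^bsub>M\<^esub> k = c \<odot>\<^bsub>M\<^esub> (f k \<ominus>\<^bsub>M\<^esub> a \<odot>\<^bsub>M\<^esub> k)"
      using that k cl by (simp add: ev_def a_minus_def smult_r_distr smult_assoc1 smult_r_minus)
    then show ?thesis using that Pm(2) by (simp add: ev_def)
  qed
  have ev_comp: "ev (\<lambda>x. f (g x)) (a \<otimes> b)" if "f \<in> ?S" "g \<in> ?S" "ev f a" "ev g b" for f g a b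
  proof -
    have ab: "a \<in> carrier R" "b \<in> carrier R" using that by (auto simp: ev_def)
    \<comment> \<open>Modulo \<open>P\<close>, which \<open>f\<close> preserves,
      \<open>f (g k)\<close> is \<open>b (f k)\<close>, and \<open>f k\<close> is in turn
      \<open>a k\<close>.\<close>
    have "f (g k \<ominus>\<^bsub>M\<^esub> b \<odot>\<^bsub>M\<^esub> k) \<in> P"
      using that(4) endo_polys_stable[OF P that(1)] by (simp add: ev_def)
    moreover have "f (g k \<ominus>\<^bsub>M\<^esub> b \<odot>\<^bsub>M\<^esub> k) = f (g k) \<ominus>\<^bsub>M\<^esub> b \<odot>\<^bsub>M\<^esub> f k"
      using hom[OF that(1)] ab k cl that(2)
      by (simp add: module_hom_diff[OF module_axioms module_axioms] module_hom_smult)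
    moreover have "b \<odot>\<^bsub>M\<^esub> (f k \<ominus>\<^bsub>M\<^esub> a \<odot>\<^bsub>M\<^esub> k) \<in> P" using that Pm by (simp add: ev_def)
    ultimately have "(f (g k) \<ominus>\<^bsub>M\<^esub> b \<odot>\<^bsub>M\<^esub> f k) \<oplus>\<^bsub>M\<^esub> b \<odot>\<^bsub>M\<^esub> (f k \<ominus>\<^bsub>M\<^esub> a \<odot>\<^bsub>M\<^esub> k) \<in> P"
      using Pm(3) by simp
    moreover have "(f (g k) \<ominus>\<^bsub>M\<^esub> b \<odot>\<^bsub>M\<^esub> f k) \<oplus>\<^bsub>M\<^esub> b \<odot>\<^bsub>M\<^esub> (f k \<ominus>\<^bsub>M\<^esub> a \<odot>\<^bsub>M\<^esub> k)
        = f (g k) \<ominus>\<^bsub>M\<^esub> (a \<otimes> b) \<odot>\<^bsub>M\<^esub> k"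
      using ab k cl that(1,2) smult_assoc1[of b a k]
      by (simp add: a_minus_def smult_r_distr smult_r_minus M.a_assoc M.r_neg1 R.m_comm)
    ultimately show ?thesis using ab by (simp add: ev_def)
  qed
  have ev_ex: "\<exists>a. ev f a" if "f \<in> ?S" for f
    using that
  proof induction
    case (comp f g) then show ?case using ev_comp by blast
  next
    case (plus f g) then show ?case using ev_plus by blast
  next
    case (scale a f) then show ?case using ev_scale by blast
  qed (use ev_ident ev_base in blast)+
  define T where "T = {t \<in> ?S. \<exists>j\<in>J. ev t (\<one> \<ominus> j)}"
  \<comment> \<open>Generalised from \<open>P\<close> to every \<open>\<phi>\<close>-stable
    \<open>Q\<close> above it, because \<open>Q\<close> absorbs the generators one by one. The last
    premise says that \<open>Q\<close> and \<open>E\<close> together generate \<open>M\<close> over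
    \<open>R[\<phi>]\<close>; for empty \<open>E\<close> it forces \<open>Q = M\<close>, and the
    identity serves as \<open>t\<close>.\<close>
  have claim: "\<exists>t\<in>T. \<forall>x\<in>carrier M. t x \<in> Q"
    if "finite E" "E \<subseteq> carrier M" "submodule Q R M" "P \<subseteq> Q" "\<And>x. x \<in> Q \<Longrightarrow> \<phi> x \<in> Q"
      "\<And>H. submodule H R M \<Longrightarrow> Q \<subseteq> H \<Longrightarrow> E \<subseteq> H \<Longrightarrow> (\<And>x. x \<in> H \<Longrightarrow> \<phi> x \<in> H) \<Longrightarrow> carrier M \<subseteq> H"
    for E Q
    using that
  proof (induction E arbitrary: Q rule: finite_induct)
    case empty
    have "carrier M \<subseteq> Q" using empty by blast
    moreover have "ev (\<lambda>x. x) (\<one> \<ominus> \<zero>)" using ev_ident by (simp add: a_minus_def)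
    ultimately have "(\<lambda>x. x) \<in> T" unfolding T_def using endo_polys.ident J.zero_closed by auto
    then show ?case using \<open>carrier M \<subseteq> Q\<close> by (intro bexI[of _ "\<lambda>x. x"]) auto
  next
    case (insert e E)
    note Q = insert.prems(2)
    note Qs = insert.prems(4)
    have Qc: "x \<in> carrier M" if "x \<in> Q" for x using submoduleE(1)[OF Q] that by auto
    have e: "e \<in> carrier M" using insert.prems by simp
    \<comment> \<open>\<open>Q + R[\<phi>] e\<close>: the generator \<open>e\<close> moves from
      \<open>E\<close> into the submodule, so the induction hypothesis gives \<open>t\<close> with
      \<open>t M\<close> inside \<open>Q'\<close>. It remains to find a further factor that pushes
      \<open>Q'\<close> into \<open>Q\<close>.\<close>
    define Q' where "Q' = {q \<oplus>\<^bsub>M\<^esub> s e |q s. q \<in> Q \<and> s \<in> ?S}"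
    have Q'I: "q \<oplus>\<^bsub>M\<^esub> s e \<in> Q'" if "q \<in> Q" "s \<in> ?S" for q s
      using that unfolding Q'_def by blast
    have Q'E: "\<exists>q s. x = q \<oplus>\<^bsub>M\<^esub> s e \<and> q \<in> Q \<and> s \<in> ?S" if "x \<in> Q'" for x
      using that unfolding Q'_def mem_Collect_eq .
    have Q': "submodule Q' R M"
      unfolding Q'_def using hom endo_polys.ident[of R M \<phi>]
      by (intro submodule_plus_orbit[OF Q e]) (blast intro: endo_polys.plus endo_polys.scale)+
    have QQ': "Q \<subseteq> Q'"
    proof
      fix q assume q: "q \<in> Q"
      have "q = q \<oplus>\<^bsub>M\<^esub> \<zero> \<odot>\<^bsub>M\<^esub> e" using q e Qc by simp
      then show "q \<in> Q'"
        using Q'I[OF q endo_polys.scale[OF R.zero_closed endo_polys.ident]] by simp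
    qed
    have eQ': "e \<in> Q'"
    proof -
      have "e = \<zero>\<^bsub>M\<^esub> \<oplus>\<^bsub>M\<^esub> e" using e by simp
      then show ?thesis
        using Q'I[OF submodule_zero_closed[OF Q] endo_polys.ident] by simp
    qed
    have "\<exists>t\<in>T. \<forall>x\<in>carrier M. t x \<in> Q'"
    proof (rule insert.IH)
      show "E \<subseteq> carrier M" "submodule Q' R M" "P \<subseteq> Q'" using insert.prems Q' QQ' by auto
      show "\<phi> x \<in> Q'" if "x \<in> Q'" for x
      proof -
        obtain q s where qs: "x = q \<oplus>\<^bsub>M\<^esub> s e" "q \<in> Q" "s \<in> ?S" using Q'E[OF \<open>x \<in> Q'\<close>] by metis
        then have "\<phi> x = \<phi> q \<oplus>\<^bsub>M\<^esub> \<phi> (s e)"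
          using \<phi> Qc cl e by (simp add: module_hom_add)
        then show ?thesis
          using Q'I[OF Qs[OF qs(2)] endo_polys.comp[OF endo_polys.base qs(3)]] by simp
      qed
      show "carrier M \<subseteq> H" if "submodule H R M" "Q' \<subseteq> H" "E \<subseteq> H" "\<And>x. x \<in> H \<Longrightarrow> \<phi> x \<in> H" for H
        using that QQ' eQ' by (intro insert.prems(5)) auto
    qed
    then obtain t j where t: "t \<in> ?S" "j \<in> J" "ev t (\<one> \<ominus> j)" and tQ': "\<And>x. x \<in> carrier M \<Longrightarrow> t x \<in> Q'"
      unfolding T_def by blast
    \<comment> \<open>The coefficient of \<open>e\<close> in \<open>t (a x)\<close>, for
      \<open>a\<close> in \<open>J\<close>, is \<open>a\<close> times a polynomial, and so acts on
      \<open>k\<close> by a scalar in \<open>J\<close>. Hence \<open>t\<close> maps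
      \<open>J M\<close> into \<open>W = Q + C e\<close>, and \<open>W\<close> contains
      \<open>t (\<phi> e)\<close> because \<open>\<phi> e\<close> lies in
      \<open>J M\<close>.\<close>
    define C where "C = {s \<in> ?S. \<exists>i\<in>J. ev s i}"
    have CI: "s \<in> C" if "s \<in> ?S" "i \<in> J" "ev s i" for s i using that by (auto simp: C_def)
    define W where "W = {q \<oplus>\<^bsub>M\<^esub> s e |q s. q \<in> Q \<and> s \<in> C}"
    have Cscale: "(\<lambda>x. a \<odot>\<^bsub>M\<^esub> s x) \<in> C" if "a \<in> J" "s \<in> ?S" for a s
    proof -
      obtain b where b: "ev s b" using ev_ex \<open>s \<in> ?S\<close> by blast
      then have "a \<otimes> b \<in> J" using that J.I_r_closed by (simp add: ev_def)
      then show ?thesis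
        by (rule CI[OF endo_polys.scale[OF Jc[OF that(1)] that(2)] _ ev_scale[OF that(2) Jc[OF that(1)] b]])
    qed
    have WI: "q \<oplus>\<^bsub>M\<^esub> s e \<in> W" if "q \<in> Q" "s \<in> C" for q s
      using that unfolding W_def by blast
    have W: "submodule W R M"
      unfolding W_def
    proof (rule submodule_plus_orbit[OF Q e])
      show "C \<subseteq> module_hom R M M" using hom by (auto simp: C_def)
      show "C \<noteq> {}" using Cscale[OF J.zero_closed endo_polys.ident] by blast
      show "(\<lambda>x. f x \<oplus>\<^bsub>M\<^esub> g x) \<in> C" if "f \<in> C" "g \<in> C" for f g
      proof -
        obtain i i' where "f \<in> ?S" "g \<in> ?S" "i \<in> J" "i' \<in> J" "ev f i" "ev g i'"
          using \<open>f \<in> C\<close> \<open>g \<in> C\<close> unfolding C_def by blast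
        then show ?thesis by (intro CI[of _ "i \<oplus> i'"] endo_polys.plus ev_plus J.a_closed)
      qed
      show "(\<lambda>x. a \<odot>\<^bsub>M\<^esub> f x) \<in> C" if "f \<in> C" "a \<in> carrier R" for f a
      proof -
        obtain i where "f \<in> ?S" "i \<in> J" "ev f i" using \<open>f \<in> C\<close> unfolding C_def by blast
        then show ?thesis using that(2) by (intro CI[of _ "a \<otimes> i"] endo_polys.scale ev_scale J.I_l_closed)
      qed
    qed
    have "submodule {x \<in> carrier M. t x \<in> W} R M"
      using hom[OF t(1)] submoduleE(3-5)[OF W]
      by (intro submoduleI)
        (auto simp: module_hom_zero[OF module_axioms module_axioms] submodule_zero_closed[OF W]
          module_hom_a_inv[OF module_axioms module_axioms] module_hom_add module_hom_smult)
    moreover have "a \<odot>\<^bsub>M\<^esub> x \<in> {x \<in> carrier M. t x \<in> W}" if "a \<in> J" "x \<in> carrier M" for a x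
    proof -
      obtain q s where qs: "t x = q \<oplus>\<^bsub>M\<^esub> s e" "q \<in> Q" "s \<in> ?S"
        using Q'E[OF tQ'[OF \<open>x \<in> carrier M\<close>]] by metis
      have "t (a \<odot>\<^bsub>M\<^esub> x) = a \<odot>\<^bsub>M\<^esub> q \<oplus>\<^bsub>M\<^esub> a \<odot>\<^bsub>M\<^esub> s e"
        using hom[OF t(1)] that Jc qs Qc cl e by (simp add: module_hom_smult smult_r_distr)
      moreover have "a \<odot>\<^bsub>M\<^esub> q \<in> Q" using submoduleE(4)[OF Q] that Jc qs by simp
      ultimately have "t (a \<odot>\<^bsub>M\<^esub> x) \<in> W"
        using WI[OF _ Cscale[OF that(1) qs(3)]] by simp
      then show ?thesis using that Jc by simp
    qed
    ultimately have "ideal_smult R M J \<subseteq> {x \<in> carrier M. t x \<in> W}"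
      unfolding ideal_smult_def module_span_def by blast
    then have "t (\<phi> e) \<in> W" using \<phi>J e by blast
    then obtain q s i where qs: "t (\<phi> e) = q \<oplus>\<^bsub>M\<^esub> s e" "q \<in> Q" "s \<in> ?S" "i \<in> J" "ev s i"
      unfolding W_def C_def mem_Collect_eq by metis
    \<comment> \<open>From \<open>t (\<phi> e) = q + s e\<close> the map \<open>t \<phi> - s\<close>
      sends \<open>e\<close> to \<open>q\<close> in \<open>Q\<close>. Its scalar on \<open>k\<close>
      is \<open>(1 - j) 1 - i\<close>, which is again \<open>1\<close> minus an element of
      \<open>J\<close>.\<close>
    define t' where "t' = (\<lambda>x. t (\<phi> x) \<oplus>\<^bsub>M\<^esub> \<ominus> \<one> \<odot>\<^bsub>M\<^esub> s x)"
    have t'S: "t' \<in> ?S" unfolding t'_def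
      by (intro endo_polys.plus endo_polys.comp[OF t(1) endo_polys.base] endo_polys.scale qs) simp
    have "ev t' ((\<one> \<ominus> j) \<otimes> \<one> \<oplus> \<ominus> \<one> \<otimes> i)" unfolding t'_def
      by (intro ev_plus ev_comp ev_scale ev_base endo_polys.comp[OF t(1) endo_polys.base]
          endo_polys.scale endo_polys.base qs t) simp_all
    then have ev': "ev t' (\<one> \<ominus> (j \<oplus> i))"
      using t(2) qs(4) Jc by (simp add: a_minus_def R.l_minus R.minus_add R.a_assoc)
    have t'e: "t' e \<in> Q"
    proof -
      have "t' e = q"
        using qs e Qc cl by (simp add: t'_def smult_l_minus M.a_assoc M.r_neg)
      then show ?thesis using qs by simp
    qed
    have "ev (\<lambda>x. t' (t x)) ((\<one> \<ominus> (j \<oplus> i)) \<otimes> (\<one> \<ominus> j))"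
      by (rule ev_comp[OF t'S t(1) ev' t(3)])
    moreover have "(\<one> \<ominus> (j \<oplus> i)) \<otimes> (\<one> \<ominus> j) = \<one> \<ominus> (j \<oplus> (j \<oplus> i) \<otimes> (\<one> \<ominus> j))"
      using t(2) qs(4) Jc
      by (simp add: a_minus_def R.l_distr R.r_distr R.l_minus R.r_minus R.minus_add R.a_ac)
    moreover have "j \<oplus> (j \<oplus> i) \<otimes> (\<one> \<ominus> j) \<in> J"
      using t(2) qs(4) Jc by (intro J.a_closed J.I_r_closed) auto
    ultimately have "(\<lambda>x. t' (t x)) \<in> T"
      unfolding T_def using endo_polys.comp[OF t'S t(1)] by auto
    \<comment> \<open>Commutativity of \<open>R[\<phi>]\<close> turns \<open>t' (s' e)\<close> into
      \<open>s' (t' e)\<close>, which lies in the stable submodule \<open>Q\<close>.\<close>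
    moreover have "t' (t x) \<in> Q" if x: "x \<in> carrier M" for x
    proof -
      obtain q' s' where *: "t x = q' \<oplus>\<^bsub>M\<^esub> s' e" "q' \<in> Q" "s' \<in> ?S"
        using Q'E[OF tQ'[OF x]] by metis
      then have "t' (t x) = t' q' \<oplus>\<^bsub>M\<^esub> s' (t' e)"
        using hom[OF t'S] Qc cl e endo_polys_commute[OF \<phi> t'S *(3) e] by (simp add: module_hom_add)
      moreover have "t' q' \<in> Q" "s' (t' e) \<in> Q"
        using endo_polys_stable[OF Q Qs t'S *(2)] endo_polys_stable[OF Q Qs *(3) t'e] by blast+
      ultimately show ?thesis using submoduleE(5)[OF Q] by simp
    qed
    ultimately show ?case by (intro bexI[of _ "\<lambda>x. t' (t x)"]) auto
  qed
  have "\<exists>t\<in>T. \<forall>x\<in>carrier M. t x \<in> P"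
    by (rule claim[OF fin(1,2) P(1) order.refl P(2)]) (use fin(3) in \<open>auto simp: module_span_def\<close>)
  then obtain t j where t: "t \<in> ?S" "j \<in> J" "ev t (\<one> \<ominus> j)" "t k \<in> P"
    unfolding T_def using k(1) by blast
  have u: "\<one> \<ominus> j \<in> Units R" using one_minus_jacobson_radical_Units J(2) t(2) by blast
  have uc: "\<one> \<ominus> j \<in> carrier R" using t(2) Jc by simp
  have "t k \<ominus>\<^bsub>M\<^esub> (t k \<ominus>\<^bsub>M\<^esub> (\<one> \<ominus> j) \<odot>\<^bsub>M\<^esub> k) \<in> P"
    using submodule_diff_closed[OF P(1)] t by (simp add: ev_def)
  moreover have "t k \<ominus>\<^bsub>M\<^esub> (t k \<ominus>\<^bsub>M\<^esub> (\<one> \<ominus> j) \<odot>\<^bsub>M\<^esub> k) = (\<one> \<ominus> j) \<odot>\<^bsub>M\<^esub> k"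
    using cl[OF t(1) k(1)] smult_closed[OF uc k(1)]
    by (simp only: a_minus_def[of M] M.minus_add M.minus_minus M.a_inv_closed M.r_neg2 M.a_assoc[symmetric] M.r_neg M.l_zero)
  ultimately have "inv (\<one> \<ominus> j) \<odot>\<^bsub>M\<^esub> ((\<one> \<ominus> j) \<odot>\<^bsub>M\<^esub> k) \<in> P"
    using Pm(2) Units_inv_closed[OF u] by simp
  then show "k \<in> P"
    using smult_assoc1[OF Units_inv_closed[OF u] uc k(1)] Units_l_inv[OF u] k(1) by simp
qed

end

subsection \<open>Free modules of finite rank\<close>

text \<open>Ideals and \<open>R\<close> itself become modules on the type of ring elements, which is
  exactly the type of test modules at which flatness is assumed.\<close>

definition ring_module :: "('a, 'r) ring_scheme \<Rightarrow> 'a set \<Rightarrow> ('a, 'a) module"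
  where "ring_module R I =
    \<lparr>carrier = I, monoid.mult = monoid.mult R, monoid.one = monoid.one R,
     ring.zero = ring.zero R, ring.add = ring.add R, smult = monoid.mult R\<rparr>"

lemma ring_module_simps [simp]:
  "carrier (ring_module R I) = I" "ring.zero (ring_module R I) = ring.zero R"
  "ring.add (ring_module R I) = ring.add R" "smult (ring_module R I) = monoid.mult R"
  by (simp_all add: ring_module_def)

lemma module_ring_module:
  assumes "cring R" "ideal I R"
  shows "module R (ring_module R I)"
proof -
  interpret cring R by fact
  interpret I: ideal I R by fact
  note Ic = I.a_Hcarr
  show ?thesis
  proof (rule moduleI)
    show "abelian_group (ring_module R I)"
    proof (rule abelian_groupI)
      fix x assume x: "x \<in> carrier (ring_module R I)"
      then have "\<ominus>\<^bsub>R\<^esub> x \<oplus>\<^bsub>R\<^esub> x = \<zero>\<^bsub>R\<^esub>" using Ic l_neg by simp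
      moreover have "\<ominus>\<^bsub>R\<^esub> x \<in> I" using x I.a_inv_closed by (simp add: a_inv_def)
      ultimately show "\<exists>y\<in>carrier (ring_module R I). y \<oplus>\<^bsub>ring_module R I\<^esub> x = \<zero>\<^bsub>ring_module R I\<^esub>"
        by auto
    qed (auto simp: Ic a_assoc intro: a_comm)
  qed (auto simp: Ic l_distr r_distr m_assoc I.I_l_closed intro: is_cring)
qed

lemma module_hom_scalar:
  assumes "module R V" "w \<in> carrier V" "l \<in> module_hom R M (ring_module R (carrier R))"
  shows "(\<lambda>v. l v \<odot>\<^bsub>V\<^esub> w) \<in> module_hom R M V"
proof -
  interpret V: module R V by fact
  show ?thesis
    using assms(2,3) module_hom_closed[OF assms(3)]
    by (intro module_homI) (simp_all add: module_hom_add module_hom_smult V.smult_l_distr V.smult_assoc1)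
qed

text \<open>This is the full power \<open>R^X\<close>, with no condition on supports, so it is free
  on \<open>X\<close> when \<open>X\<close> is finite. Extensional functions make equality of
  vectors the same as equality of coordinates.\<close>

definition free_mod :: "('a, 'r) ring_scheme \<Rightarrow> 'i set \<Rightarrow> ('a, 'i \<Rightarrow> 'a) module"
  where "free_mod R X =
    \<lparr>carrier = X \<rightarrow>\<^sub>E carrier R, monoid.mult = undefined, monoid.one = undefined,
     ring.zero = (\<lambda>x\<in>X. \<zero>\<^bsub>R\<^esub>), ring.add = (\<lambda>u v. \<lambda>x\<in>X. u x \<oplus>\<^bsub>R\<^esub> v x),
     smult = (\<lambda>a v. \<lambda>x\<in>X. a \<otimes>\<^bsub>R\<^esub> v x)\<rparr>"

definition unit_vec :: "('a, 'r) ring_scheme \<Rightarrow> 'i set \<Rightarrow> 'i \<Rightarrow> 'i \<Rightarrow> 'a"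
  where "unit_vec R X x = (\<lambda>y\<in>X. if x = y then \<one>\<^bsub>R\<^esub> else \<zero>\<^bsub>R\<^esub>)"

definition lincomb :: "('a, 'b, 'm) module_scheme \<Rightarrow> 'i set \<Rightarrow> ('i \<Rightarrow> 'b) \<Rightarrow> ('i \<Rightarrow> 'a) \<Rightarrow> 'b"
  where "lincomb V X v c = (\<Oplus>\<^bsub>V\<^esub>x\<in>X. c x \<odot>\<^bsub>V\<^esub> v x)"

lemma free_mod_simps [simp]:
  "carrier (free_mod R X) = X \<rightarrow>\<^sub>E carrier R"
  "ring.zero (free_mod R X) = (\<lambda>x\<in>X. \<zero>\<^bsub>R\<^esub>)"
  "u \<oplus>\<^bsub>free_mod R X\<^esub> v = (\<lambda>x\<in>X. u x \<oplus>\<^bsub>R\<^esub> v x)"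
  "a \<odot>\<^bsub>free_mod R X\<^esub> v = (\<lambda>x\<in>X. a \<otimes>\<^bsub>R\<^esub> v x)"
  by (simp_all add: free_mod_def)

lemma coord_closed: "v \<in> X \<rightarrow>\<^sub>E carrier R \<Longrightarrow> x \<in> X \<Longrightarrow> v x \<in> carrier R"
  by (rule PiE_mem)

lemma module_free_mod:
  assumes "cring R"
  shows "module R (free_mod R X)"
proof -
  interpret cring R by fact
  show ?thesis
  proof (rule moduleI)
    show "abelian_group (free_mod R X)"
    proof (rule abelian_groupI)
      fix v assume v: "v \<in> carrier (free_mod R X)"
      then show "\<exists>u\<in>carrier (free_mod R X). u \<oplus>\<^bsub>free_mod R X\<^esub> v = \<zero>\<^bsub>free_mod R X\<^esub>"
        by (intro bexI[of _ "\<lambda>x\<in>X. \<ominus>\<^bsub>R\<^esub> v x"])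
          (auto simp: coord_closed l_neg intro!: restrict_ext)
      show "\<zero>\<^bsub>free_mod R X\<^esub> \<oplus>\<^bsub>free_mod R X\<^esub> v = v"
        using v by (auto intro!: PiE_ext[of _ X "\<lambda>_. carrier R"] simp: coord_closed)
    qed (auto simp: coord_closed a_ac intro!: restrict_ext)
  next
    fix v assume v: "v \<in> carrier (free_mod R X)"
    then show "\<one>\<^bsub>R\<^esub> \<odot>\<^bsub>free_mod R X\<^esub> v = v"
      by (auto intro!: PiE_ext[of _ X "\<lambda>_. carrier R"] simp: coord_closed)
  qed (auto simp: coord_closed l_distr r_distr m_assoc is_cring intro!: restrict_ext)
qed

context cring
begin

lemma unit_vec_closed: "unit_vec R X x \<in> carrier (free_mod R X)"
  by (auto simp: unit_vec_def)

lemma coordinate_hom: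
  "x \<in> X \<Longrightarrow> (\<lambda>v. v x) \<in> module_hom R (free_mod R X) (ring_module R (carrier R))"
  by (rule module_homI) (auto simp: coord_closed)

lemma module_self: "module R (ring_module R (carrier R))"
  by (rule module_ring_module[OF is_cring oneideal])

lemma lincomb_unit_vec:
  assumes "finite X" and v: "v \<in> carrier (free_mod R X)"
  shows "lincomb (free_mod R X) X (unit_vec R X) v = v"
proof -
  let ?F = "free_mod R X"
  interpret F: module R ?F by (rule module_free_mod[OF is_cring])
  interpret S: module R "ring_module R (carrier R)" by (rule module_self)
  have c: "v x \<odot>\<^bsub>?F\<^esub> unit_vec R X x \<in> carrier ?F" if "x \<in> X" for x
    using v that unit_vec_closed[of X x] by (intro F.smult_closed) (auto simp: coord_closed)
  have "lincomb ?F X (unit_vec R X) v \<in> carrier ?F"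
    unfolding lincomb_def using c by (intro F.finsum_closed) auto
  moreover have "lincomb ?F X (unit_vec R X) v y = v y" if y: "y \<in> X" for y
  proof -
    have "lincomb ?F X (unit_vec R X) v y
        = (\<Oplus>\<^bsub>ring_module R (carrier R)\<^esub>x\<in>X. (v x \<odot>\<^bsub>?F\<^esub> unit_vec R X x) y)"
      unfolding lincomb_def
      by (rule module_hom_finsum[OF F.module_axioms S.module_axioms coordinate_hom[OF y]]) (use c in auto)
    also have "\<dots> = (\<Oplus>\<^bsub>ring_module R (carrier R)\<^esub>x\<in>X. if y = x then v x else \<zero>\<^bsub>ring_module R (carrier R)\<^esub>)"
      by (rule S.finsum_cong') (use y v in \<open>auto simp: unit_vec_def coord_closed\<close>)
    also have "\<dots> = v y"
      using y v assms(1) by (intro S.finsum_singleton) (auto simp: coord_closed)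
    finally show ?thesis .
  qed
  ultimately show ?thesis using v by (auto intro: PiE_ext[of _ X "\<lambda>_. carrier R"])
qed

lemma module_hom_lincomb:
  assumes "module R V" "module R W" "f \<in> module_hom R V W" "v \<in> X \<rightarrow> carrier V" "c \<in> X \<rightarrow> carrier R"
  shows "f (lincomb V X v c) = lincomb W X (\<lambda>x. f (v x)) c"
proof -
  interpret V: module R V by fact
  interpret W: module R W by fact
  have "f (lincomb V X v c) = (\<Oplus>\<^bsub>W\<^esub>x\<in>X. f (c x \<odot>\<^bsub>V\<^esub> v x))"
    unfolding lincomb_def using assms by (intro module_hom_finsum) auto
  also have "\<dots> = lincomb W X (\<lambda>x. f (v x)) c"
    unfolding lincomb_def
    by (rule W.finsum_cong')
      (use assms module_hom_closed[OF assms(3)] in \<open>auto simp: module_hom_smult Pi_iff\<close>)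
  finally show ?thesis .
qed

lemma lincomb_hom:
  assumes "module R V" "v \<in> X \<rightarrow> carrier V"
  shows "lincomb V X v \<in> module_hom R (free_mod R X) V"
proof -
  interpret V: module R V by fact
  have t: "(\<lambda>x. c x \<odot>\<^bsub>V\<^esub> v x) \<in> X \<rightarrow> carrier V" if "c \<in> X \<rightarrow>\<^sub>E carrier R" for c
    using that assms(2) by (auto simp: coord_closed Pi_iff)
  show ?thesis
  proof (rule module_homI)
    fix c assume "c \<in> carrier (free_mod R X)"
    then show "lincomb V X v c \<in> carrier V" unfolding lincomb_def using t by simp
  next
    fix c d assume cd: "c \<in> carrier (free_mod R X)" "d \<in> carrier (free_mod R X)"
    have "lincomb V X v (c \<oplus>\<^bsub>free_mod R X\<^esub> d) = (\<Oplus>\<^bsub>V\<^esub>x\<in>X. c x \<odot>\<^bsub>V\<^esub> v x \<oplus>\<^bsub>V\<^esub> d x \<odot>\<^bsub>V\<^esub> v x)"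
      unfolding lincomb_def using cd assms(2)
      by (intro V.finsum_cong') (auto simp: V.smult_l_distr coord_closed Pi_iff)
    then show "lincomb V X v (c \<oplus>\<^bsub>free_mod R X\<^esub> d) = lincomb V X v c \<oplus>\<^bsub>V\<^esub> lincomb V X v d"
      unfolding lincomb_def using cd t by (simp add: V.finsum_addf)
  next
    fix a c assume ac: "a \<in> carrier R" "c \<in> carrier (free_mod R X)"
    have "(\<lambda>x. a \<odot>\<^bsub>V\<^esub> x) \<in> module_hom R V V"
      by (rule module_hom_scale[OF assms(1) module_hom_ident ac(1)])
    then have "a \<odot>\<^bsub>V\<^esub> lincomb V X v c = (\<Oplus>\<^bsub>V\<^esub>x\<in>X. a \<odot>\<^bsub>V\<^esub> (c x \<odot>\<^bsub>V\<^esub> v x))"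
      unfolding lincomb_def using ac t by (intro module_hom_finsum[OF assms(1) assms(1)]) auto
    also have "\<dots> = lincomb V X v (a \<odot>\<^bsub>free_mod R X\<^esub> c)"
      unfolding lincomb_def using ac assms(2)
      by (intro V.finsum_cong') (auto simp: V.smult_assoc1 coord_closed Pi_iff)
    finally show "lincomb V X v (a \<odot>\<^bsub>free_mod R X\<^esub> c) = a \<odot>\<^bsub>V\<^esub> lincomb V X v c" by simp
  qed
qed

lemma lincomb_of_unit_vec:
  assumes "module R V" "finite X" "v \<in> X \<rightarrow> carrier V" "x \<in> X"
  shows "lincomb V X v (unit_vec R X x) = v x"
proof -
  interpret V: module R V by fact
  have "lincomb V X v (unit_vec R X x) = (\<Oplus>\<^bsub>V\<^esub>y\<in>X. if x = y then v y else \<zero>\<^bsub>V\<^esub>)"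
    unfolding lincomb_def using assms(3)
    by (intro V.finsum_cong') (auto simp: unit_vec_def Pi_iff)
  also have "\<dots> = v x" using assms by (intro V.finsum_singleton) auto
  finally show ?thesis .
qed

lemma free_mod_hom_expand:
  assumes "module R V" "finite X" "h \<in> module_hom R (free_mod R X) V" "c \<in> carrier (free_mod R X)"
  shows "h c = lincomb V X (\<lambda>x. h (unit_vec R X x)) c"
  using module_hom_lincomb[OF module_free_mod[OF is_cring] assms(1,3), of "unit_vec R X" X c]
    lincomb_unit_vec[OF assms(2,4)] assms(4) unit_vec_closed[of X] by (auto simp: coord_closed)

lemma free_mod_hom_ext:
  assumes "module R V" "finite X" "f \<in> module_hom R (free_mod R X) V" "g \<in> module_hom R (free_mod R X) V"
    and "\<And>x. x \<in> X \<Longrightarrow> f (unit_vec R X x) = g (unit_vec R X x)"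
    and c: "c \<in> carrier (free_mod R X)"
  shows "f c = g c"
proof -
  interpret V: module R V by fact
  note * = free_mod_hom_expand[OF assms(1,2) _ c]
  show ?thesis
    unfolding *[OF assms(3)] *[OF assms(4)] lincomb_def
    by (rule V.finsum_cong')
      (use assms(5) c module_hom_closed[OF assms(4) unit_vec_closed] in \<open>auto simp: coord_closed\<close>)
qed

end

section \<open>Generation of free modules by unit vectors\<close>

lemma (in module) submodule_finsum_closed:
  assumes "submodule P R M" "g \<in> A \<rightarrow> P"
  shows "(\<Oplus>\<^bsub>M\<^esub>i\<in>A. g i) \<in> P"
  using assms(2)
proof (induction A rule: infinite_finite_induct)
  case (insert i A)
  then have "g \<in> A \<rightarrow> carrier M" "g i \<in> carrier M" using submoduleE(1)[OF assms(1)] by auto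
  then show ?case using insert submoduleE(5)[OF assms(1)] by simp
qed (use submodule_zero_closed[OF assms(1)] in simp_all)

lemma (in cring) submodule_free_mod_lincomb:
  assumes "finite X" "submodule P R (free_mod R X)" "v \<in> carrier (free_mod R X)"
    and "\<And>x. x \<in> X \<Longrightarrow> v x \<odot>\<^bsub>free_mod R X\<^esub> unit_vec R X x \<in> P"
  shows "v \<in> P"
proof -
  interpret F: module R "free_mod R X" by (rule module_free_mod[OF is_cring])
  have "lincomb (free_mod R X) X (unit_vec R X) v \<in> P"
    unfolding lincomb_def using assms(4) by (intro F.submodule_finsum_closed[OF assms(2)]) auto
  then show ?thesis using lincomb_unit_vec[OF assms(1,3)] by simp
qed

lemma (in cring) module_span_unit_vec:
  assumes "finite X"
  shows "module_span R (free_mod R X) (unit_vec R X ` X) = carrier (free_mod R X)"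
proof -
  interpret F: module R "free_mod R X" by (rule module_free_mod[OF is_cring])
  have S: "submodule (module_span R (free_mod R X) (unit_vec R X ` X)) R (free_mod R X)"
    using unit_vec_closed by (intro F.module_span_submodule image_subsetI)
  have "v \<in> module_span R (free_mod R X) (unit_vec R X ` X)" if "v \<in> carrier (free_mod R X)" for v
  proof (rule submodule_free_mod_lincomb[OF assms S that])
    fix x assume "x \<in> X"
    then show "v x \<odot>\<^bsub>free_mod R X\<^esub> unit_vec R X x \<in> module_span R (free_mod R X) (unit_vec R X ` X)"
      using that by (intro F.submoduleE(4)[OF S]) (auto simp: module_span_def coord_closed)
  qed
  then show ?thesis using F.submoduleE(1)[OF S] by blast
qed

lemma (in cring) free_mod_ideal_smultI:
  assumes "finite X" "ideal J R" "v \<in> carrier (free_mod R X)" "\<And>x. x \<in> X \<Longrightarrow> v x \<in> J"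
  shows "v \<in> ideal_smult R (free_mod R X) J"
proof -
  interpret F: module R "free_mod R X" by (rule module_free_mod[OF is_cring])
  show ?thesis
    using assms(4) by (intro submodule_free_mod_lincomb[OF assms(1) F.ideal_smult_submodule[OF assms(2)] assms(3)]
        F.ideal_smult_mem unit_vec_closed)
qed

subsection \<open>The equational criterion of flatness\<close>

lemma tensor_relationsI:
  shows "x \<in> carrier N \<Longrightarrow> x' \<in> carrier N \<Longrightarrow> y \<in> carrier M \<Longrightarrow>
      frag_of (x \<oplus>\<^bsub>N\<^esub> x', y) - frag_of (x, y) - frag_of (x', y) \<in> tensor_relations R N M"
    and "x \<in> carrier N \<Longrightarrow> y \<in> carrier M \<Longrightarrow> y' \<in> carrier M \<Longrightarrow>
      frag_of (x, y \<oplus>\<^bsub>M\<^esub> y') - frag_of (x, y) - frag_of (x, y') \<in> tensor_relations R N M"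
    and "a \<in> carrier R \<Longrightarrow> x \<in> carrier N \<Longrightarrow> y \<in> carrier M \<Longrightarrow>
      frag_of (a \<odot>\<^bsub>N\<^esub> x, y) - frag_of (x, a \<odot>\<^bsub>M\<^esub> y) \<in> tensor_relations R N M"
  unfolding tensor_relations_def by (rule generate.incl, blast)+

lemma tensor_relations_add:
  assumes "module R N" "module R M" "c \<in> tensor_relations R N M" "d \<in> tensor_relations R N M"
  shows "c + d \<in> tensor_relations R N M"
  using subgroup.m_closed[OF tensor_relations_subgroup[OF assms(1,2)] assms(3,4)] by simp

lemma tensor_relations_uminus:
  assumes "module R N" "module R M" "c \<in> tensor_relations R N M"
  shows "- c \<in> tensor_relations R N M"
proof -
  have "c \<in> carrier (free_Abelian_group (carrier N \<times> carrier M))"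
    using subgroup.subset[OF tensor_relations_subgroup[OF assms(1,2)]] assms(3) by blast
  then show ?thesis
    using subgroup.m_inv_closed[OF tensor_relations_subgroup[OF assms(1,2)] assms(3)] by simp
qed

lemma tensor_relations_zero:
  assumes "module R N" "module R M"
  shows "0 \<in> tensor_relations R N M"
  using subgroup.one_closed[OF tensor_relations_subgroup[OF assms]] by simp

lemma tensor_relations_finsum:
  assumes N: "module R N" and M: "module R M" and "x \<in> carrier N" "finite A" "y \<in> A \<rightarrow> carrier M"
  shows "(\<Sum>i\<in>A. frag_of (x, y i)) - frag_of (x, \<Oplus>\<^bsub>M\<^esub>i\<in>A. y i) \<in> tensor_relations R N M"
  using assms(4,5)
proof (induction A rule: finite_induct)
  case empty
  interpret M: module R M by fact
  \<comment> \<open>Additivity in the second argument at \<open>y = y' = 0\<close> leaves just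
    \<open>- frag_of (x, 0)\<close>, so \<open>x \<otimes> 0\<close> vanishes.\<close>
  show ?case
    using tensor_relationsI(2)[OF assms(3) M.zero_closed M.zero_closed] by simp
next
  case (insert i A)
  interpret M: module R M by fact
  have c: "y i \<in> carrier M" "(\<Oplus>\<^bsub>M\<^esub>i\<in>A. y i) \<in> carrier M" "y \<in> A \<rightarrow> carrier M"
    using insert.prems by auto
  have "((\<Sum>i\<in>A. frag_of (x, y i)) - frag_of (x, \<Oplus>\<^bsub>M\<^esub>i\<in>A. y i))
      + - (frag_of (x, y i \<oplus>\<^bsub>M\<^esub> (\<Oplus>\<^bsub>M\<^esub>i\<in>A. y i)) - frag_of (x, y i) - frag_of (x, \<Oplus>\<^bsub>M\<^esub>i\<in>A. y i))
      \<in> tensor_relations R N M"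
    by (intro tensor_relations_add[OF N M] tensor_relations_uminus[OF N M] insert.IH
        tensor_relationsI(2) assms(3) c)
  then show ?case using insert.hyps c by (simp add: algebra_simps)
qed

text \<open>In \<open>R \<otimes> M\<close> the sum of the \<open>a x \<otimes> m x\<close> is
  \<open>1 \<otimes> 0\<close>, since the scalars can be moved across. Injectivity of
  \<open>I \<otimes> M \<rightarrow> R \<otimes> M\<close> brings the vanishing back to
  \<open>I \<otimes> M\<close>, where only scalars from \<open>R\<close> may cross and not the
  elements of \<open>I\<close> themselves.\<close>

lemma flat_module_relation_trivial:
  fixes X :: "'i set" and M :: "('a, 'b, 'm) module_scheme"
  assumes M: "module R M" and flat: "flat_module TYPE('a) R M" and I: "ideal I R"
    and X: "finite X" and a: "a \<in> X \<rightarrow> I" and m: "m \<in> X \<rightarrow> carrier M"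
    and rel: "lincomb M X m a = \<zero>\<^bsub>M\<^esub>"
  shows "(\<Sum>x\<in>X. frag_of (a x, m x)) \<in> tensor_relations R (ring_module R I) M"
proof -
  interpret M: module R M by fact
  interpret I: ideal I R by fact
  let ?N' = "ring_module R I" and ?N = "ring_module R (carrier R)"
  let ?r = "\<Sum>x\<in>X. frag_of (a x, m x)"
  let ?id = "\<lambda>x::'a. x"
  have N': "module R ?N'" and N: "module R ?N"
    using module_ring_module[OF M.is_cring] I M.oneideal by blast+
  have f: "?id \<in> module_hom R ?N' ?N" using I.a_subset by (auto simp: module_hom_def)
  have aR: "a \<in> X \<rightarrow> carrier R" using a I.a_subset by blast
  note add = tensor_relations_add[OF N M]
  have "finite Y \<Longrightarrow> Y \<subseteq> X \<Longrightarrow> (\<Sum>x\<in>Y. frag_of (a x, m x)) - (\<Sum>x\<in>Y. frag_of (\<one>\<^bsub>R\<^esub>, a x \<odot>\<^bsub>M\<^esub> m x))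
      \<in> tensor_relations R ?N M" for Y
  proof (induction Y rule: finite_induct)
    case empty then show ?case using tensor_relations_zero[OF N M] by simp
  next
    case (insert x Y)
    then have "a x \<in> carrier R" "m x \<in> carrier M" using aR m by auto
    then have "frag_of (a x, m x) - frag_of (\<one>\<^bsub>R\<^esub>, a x \<odot>\<^bsub>M\<^esub> m x) \<in> tensor_relations R ?N M"
      using tensor_relationsI(3)[of "a x" R "\<one>\<^bsub>R\<^esub>" ?N "m x" M] by simp
    from add[OF this insert.IH] insert show ?case by (simp add: algebra_simps)
  qed
  from this[OF X order.refl]
  have r1: "?r - (\<Sum>x\<in>X. frag_of (\<one>\<^bsub>R\<^esub>, a x \<odot>\<^bsub>M\<^esub> m x)) \<in> tensor_relations R ?N M" .
  have r2: "(\<Sum>x\<in>X. frag_of (\<one>\<^bsub>R\<^esub>, a x \<odot>\<^bsub>M\<^esub> m x)) - frag_of (\<one>\<^bsub>R\<^esub>, \<zero>\<^bsub>M\<^esub>) \<in> tensor_relations R ?N M"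
    using tensor_relations_finsum[OF N M _ X, of "\<one>\<^bsub>R\<^esub>" "\<lambda>x. a x \<odot>\<^bsub>M\<^esub> m x"] rel aR m
    unfolding lincomb_def by (auto simp: Pi_iff)
  have r3: "frag_of (\<one>\<^bsub>R\<^esub>, \<zero>\<^bsub>M\<^esub>) \<in> tensor_relations R ?N M"
    using tensor_relations_uminus[OF N M tensor_relationsI(2)[of "\<one>\<^bsub>R\<^esub>" ?N "\<zero>\<^bsub>M\<^esub>" M "\<zero>\<^bsub>M\<^esub>" R]] by simp
  have r: "?r \<in> tensor_relations R ?N M"
    using add[OF add[OF r1 r2] r3] by (simp add: algebra_simps)
  let ?G' = "free_Abelian_group (carrier ?N' \<times> carrier M)"
    and ?G = "free_Abelian_group (carrier ?N \<times> carrier M)"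
  interpret S': subgroup "tensor_relations R ?N' M" ?G' by (rule tensor_relations_subgroup[OF N' M])
  interpret S: subgroup "tensor_relations R ?N M" ?G by (rule tensor_relations_subgroup[OF N M])
  interpret G': group ?G' by simp
  interpret G: group ?G by simp
  have rc: "?r \<in> carrier ?G'"
    using a m by (intro sum_closed_free_Abelian_group) auto
  have e: "frag_extend (\<lambda>(x, y). frag_of (?id x, y)) c = c" for c :: "'a \<times> 'b \<Rightarrow>\<^sub>0 int"
    using frag_expansion[of c] by (simp add: case_prod_unfold)
  have "tensor_map R ?N M ?id (tensor_relations R ?N' M #>\<^bsub>?G'\<^esub> ?r)
      = tensor_relations R ?N M #>\<^bsub>?G\<^esub> ?r"
    using tensor_map_coset[OF N' N M f rc] unfolding e .
  also have "\<dots> = tensor_relations R ?N M #>\<^bsub>?G\<^esub> 0"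
    using G.coset_join2[OF _ S.subgroup_axioms r] S.mem_carrier[OF r]
      G.coset_join2[OF _ S.subgroup_axioms tensor_relations_zero[OF N M]] by simp
  also have "\<dots> = tensor_map R ?N M ?id (tensor_relations R ?N' M #>\<^bsub>?G'\<^esub> 0)"
    using tensor_map_coset[OF N' N M f, of 0] unfolding e by simp
  finally have eq: "tensor_map R ?N M ?id (tensor_relations R ?N' M #>\<^bsub>?G'\<^esub> ?r)
      = tensor_map R ?N M ?id (tensor_relations R ?N' M #>\<^bsub>?G'\<^esub> 0)" .
  have "inj_on (tensor_map R ?N M ?id) (carrier (tensor_group R ?N' M))"
    using flat[unfolded flat_module_def] N' N f by simp
  moreover have "tensor_relations R ?N' M #>\<^bsub>?G'\<^esub> c \<in> carrier (tensor_group R ?N' M)"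
    if "c \<in> carrier ?G'" for c
    using that unfolding tensor_group_def FactGroup_def RCOSETS_def by auto
  ultimately have "tensor_relations R ?N' M #>\<^bsub>?G'\<^esub> ?r = tensor_relations R ?N' M #>\<^bsub>?G'\<^esub> 0"
    using eq rc by (auto dest: inj_onD)
  also have "\<dots> = tensor_relations R ?N' M"
    using G'.coset_join2[OF _ S'.subgroup_axioms tensor_relations_zero[OF N' M]] by simp
  finally show ?thesis using G'.coset_join1[OF _ rc S'.subgroup_axioms] by simp
qed

text \<open>The equational criterion, with the relation \<open>k\<close> and its trivialisation expressed by a
  presentation \<open>p\<close> of \<open>M\<close>. A bilinear map on \<open>I \<times> M\<close>, where \<open>I\<close> is the ideal of the values
  at \<open>k\<close> of all linear forms, is obtained by choosing for each \<open>a \<in> I\<close> a form \<open>s a\<close> with value \<open>a\<close>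
  at \<open>k\<close>; it is well defined up to forms that vanish at \<open>k\<close>.\<close>
lemma flat_module_kill_relation:
  fixes X :: "'i set" and M :: "('a, 'b, 'm) module_scheme"
  assumes M: "module R M" and flat: "flat_module TYPE('a) R M" and X: "finite X"
    and p: "p \<in> module_hom R (free_mod R X) M" and surj: "p ` carrier (free_mod R X) = carrier M"
    and k: "k \<in> carrier (free_mod R X)" "p k = \<zero>\<^bsub>M\<^esub>"
  obtains b where "b \<in> module_hom R (free_mod R X) (free_mod R X)"
    "\<And>v. v \<in> carrier (free_mod R X) \<Longrightarrow> p (b v) = p v" "b k = \<zero>\<^bsub>free_mod R X\<^esub>"
proof -
  interpret M: module R M by fact
  let ?F = "free_mod R X" and ?S = "ring_module R (carrier R)"
  interpret F: module R ?F by (rule module_free_mod[OF M.is_cring])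
  interpret S: module R ?S by (rule M.module_self)
  note S = S.module_axioms and F = F.module_axioms
  define D where "D = module_hom R ?F ?S"
  have Dc: "l v \<in> carrier R" if "l \<in> D" "v \<in> carrier ?F" for l v
    using module_hom_closed[of l R ?F ?S v] that by (simp add: D_def)
  define I where "I = {l k |l. l \<in> D}"
  have II: "l k \<in> I" if "l \<in> D" for l using that by (auto simp: I_def)
  have Dplus: "(\<lambda>v. l v \<oplus>\<^bsub>R\<^esub> l' v) \<in> D" if "l \<in> D" "l' \<in> D" for l l'
    using module_hom_plus[OF S, of l _ l'] that by (simp add: D_def)
  have Dscale: "(\<lambda>v. a \<otimes>\<^bsub>R\<^esub> l v) \<in> D" if "l \<in> D" "a \<in> carrier R" for l a
    using module_hom_scale[OF S, of l _ a] that by (simp add: D_def)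
  have Dminus: "(\<lambda>v. l v \<ominus>\<^bsub>R\<^esub> l' v) \<in> D" if "l \<in> D" "l' \<in> D" for l l'
    using module_hom_minus[OF S, of l _ l'] that by (simp add: D_def a_minus_def a_inv_def m_inv_def)
  have coord: "(\<lambda>v. v x) \<in> D" if "x \<in> X" for x using M.coordinate_hom[OF that] by (simp add: D_def)
  have I_sub: "I \<subseteq> carrier R" using Dc k(1) by (auto simp: I_def)
  have Iz: "\<zero>\<^bsub>R\<^esub> \<in> I"
  proof -
    have "(\<lambda>v. \<zero>\<^bsub>R\<^esub>) \<in> D" by (auto simp: D_def module_hom_def)
    from II[OF this] show ?thesis .
  qed
  have I: "ideal I R"
  proof (rule idealI)
    show "ring R" by (rule M.ring_axioms)
    show "subgroup I (add_monoid R)"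
    proof (rule M.R.add.subgroupI)
      show "I \<subseteq> carrier R" "I \<noteq> {}" using I_sub Iz by auto
      fix a assume "a \<in> I"
      then obtain l where l: "l \<in> D" "a = l k" by (auto simp: I_def)
      show "\<ominus>\<^bsub>R\<^esub> a \<in> I"
        using II[OF Dscale[OF l(1), of "\<ominus>\<^bsub>R\<^esub> \<one>\<^bsub>R\<^esub>"]] l Dc k(1) by (simp add: M.R.l_minus)
      fix b assume "b \<in> I"
      then obtain l' where l': "l' \<in> D" "b = l' k" by (auto simp: I_def)
      show "a \<oplus>\<^bsub>R\<^esub> b \<in> I" using II[OF Dplus[OF l(1) l'(1)]] l l' by simp
    qed
    fix a r assume "a \<in> I" and r: "r \<in> carrier R"
    then obtain l where l: "l \<in> D" "a = l k" by (auto simp: I_def)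
    show "r \<otimes>\<^bsub>R\<^esub> a \<in> I" using II[OF Dscale[OF l(1) r]] l by simp
    then show "a \<otimes>\<^bsub>R\<^esub> r \<in> I" using r l Dc k(1) by (simp add: M.m_comm)
  qed
  interpret I: ideal I R by (rule I)
  let ?I = "ring_module R I"
  have Im: "module R ?I" by (rule module_ring_module[OF M.is_cring I])
  define m where "m = (\<lambda>x. p (unit_vec R X x))"
  have mc: "m \<in> X \<rightarrow> carrier M"
    unfolding m_def using module_hom_closed[OF p M.unit_vec_closed] by simp
  have pl: "p v = lincomb M X m v" if v: "v \<in> carrier ?F" for v
    using M.free_mod_hom_expand[OF M X p v] by (simp add: m_def)
  have kI: "k \<in> X \<rightarrow> I" using II[OF coord] by auto
  define r where "r = (\<Sum>x\<in>X. frag_of (k x, m x))"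
  have r: "r \<in> tensor_relations R ?I M"
    unfolding r_def
    by (rule flat_module_relation_trivial[OF M flat I X kI mc]) (use pl k in simp)
  have "\<forall>a\<in>I. \<exists>l\<in>D. l k = a" by (auto simp: I_def)
  then obtain s where s: "\<And>a. a \<in> I \<Longrightarrow> s a \<in> D" "\<And>a. a \<in> I \<Longrightarrow> s a k = a" by metis
  let ?G = "free_Abelian_group (carrier ?I \<times> carrier M)"
  \<comment> \<open>As \<open>s\<close> is a mere choice, \<open>(a, y) \<mapsto> s a v y\<close>
    need not be bilinear. It therefore lives on the free abelian group, and its effect on the tensor
    relations has to be measured.\<close>
  have "\<exists>h. h \<in> hom ?G (add_monoid M) \<and> (\<forall>a\<in>I. \<forall>y\<in>carrier M. h (frag_of (a, y)) = s a v \<odot>\<^bsub>M\<^esub> y)"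
    if v: "v \<in> carrier ?F" for v
  proof -
    have "(\<lambda>(a, y). s a v \<odot>\<^bsub>M\<^esub> y) ` (carrier ?I \<times> carrier M) \<subseteq> carrier (add_monoid M)"
      using s(1) Dc v by auto
    then obtain h where "h \<in> hom ?G (add_monoid M)"
      "\<And>x. x \<in> carrier ?I \<times> carrier M \<Longrightarrow> h (frag_of x) = (case x of (a, y) \<Rightarrow> s a v \<odot>\<^bsub>M\<^esub> y)"
      using comm_group.free_Abelian_group_universal[OF M.a_comm_group] by metis
    then show ?thesis by (intro exI[of _ h]) auto
  qed
  then obtain h where h: "\<And>v. v \<in> carrier ?F \<Longrightarrow> h v \<in> hom ?G (add_monoid M)"
    and hf: "\<And>v a y. v \<in> carrier ?F \<Longrightarrow> a \<in> I \<Longrightarrow> y \<in> carrier M \<Longrightarrow> h v (frag_of (a, y)) = s a v \<odot>\<^bsub>M\<^esub> y"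
    by metis
  have hgh: "group_hom ?G (add_monoid M) (h v)" if "v \<in> carrier ?F" for v
    using h[OF that] by (simp add: group_hom_def group_hom_axioms_def M.a_group)
  have hc: "h v c \<in> carrier M" if "v \<in> carrier ?F" "c \<in> carrier ?G" for v c
    using group_hom.hom_closed[OF hgh] that by force
  have ha: "h v (c + d) = h v c \<oplus>\<^bsub>M\<^esub> h v d"
    if "v \<in> carrier ?F" "c \<in> carrier ?G" "d \<in> carrier ?G" for v c d
    using group_hom.hom_mult[OF hgh that(2,3)] that(1) by simp
  have hz: "h v 0 = \<zero>\<^bsub>M\<^esub>" if "v \<in> carrier ?F" for v
    using group_hom.hom_one[OF hgh[OF that]] by simp
  have hi: "h v (- c) = \<ominus>\<^bsub>M\<^esub> h v c" if "v \<in> carrier ?F" "c \<in> carrier ?G" for v c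
    using group_hom.hom_inv[OF hgh that(2)] that by (simp add: a_inv_def)
  have uc: "- c \<in> carrier ?G" if "c \<in> carrier ?G" for c :: "'a \<times> 'b \<Rightarrow>\<^sub>0 int" using that by simp
  have hd: "h v (c - d) = h v c \<ominus>\<^bsub>M\<^esub> h v d"
    if "v \<in> carrier ?F" "c \<in> carrier ?G" "d \<in> carrier ?G" for v c d
    using ha[OF that(1,2) uc[OF that(3)]] hi[OF that(1,3)] by (simp add: a_minus_def)
  \<comment> \<open>The measure of failure: \<open>v \<mapsto> h v c\<close> lifts along
    \<open>p\<close> to an endomorphism of \<open>F\<close> that vanishes at \<open>k\<close>. For
    each generating relation \<open>c\<close> the defect has the form \<open>l v y\<close>, where
    \<open>l\<close> compares two linear forms with the same value at \<open>k\<close>; a preimage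
    \<open>w\<close> of \<open>y\<close> then gives the lift \<open>v \<mapsto> l v w\<close>.
    Goodness passes to sums and negatives, hence to all tensor relations.\<close>
  define good where "good c \<longleftrightarrow> (\<exists>b\<in>module_hom R ?F ?F. b k = \<zero>\<^bsub>?F\<^esub> \<and>
    (\<forall>v\<in>carrier ?F. p (b v) = h v c))" for c
  have goodI: "good c" if "l \<in> D" "l k = \<zero>\<^bsub>R\<^esub>" "y \<in> carrier M"
    "\<And>v. v \<in> carrier ?F \<Longrightarrow> h v c = l v \<odot>\<^bsub>M\<^esub> y" for c l y
  proof -
    have "y \<in> p ` carrier ?F" using that(3) surj by simp
    then obtain w where w: "w \<in> carrier ?F" "p w = y" by (elim imageE) simp
    show ?thesis unfolding good_def
    proof (intro bexI conjI ballI)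
      show "(\<lambda>v. l v \<odot>\<^bsub>?F\<^esub> w) \<in> module_hom R ?F ?F"
        using that(1) by (intro module_hom_scalar[OF F w(1)]) (simp add: D_def)
      show "l k \<odot>\<^bsub>?F\<^esub> w = \<zero>\<^bsub>?F\<^esub>" using that(2) w(1) F.smult_l_null by metis
      show "p (l v \<odot>\<^bsub>?F\<^esub> w) = h v c" if "v \<in> carrier ?F" for v
        using module_hom_smult[OF p Dc[OF \<open>l \<in> D\<close> that] w(1)] w(2) \<open>v \<in> carrier ?F\<close>
          \<open>\<And>v. v \<in> carrier ?F \<Longrightarrow> h v c = l v \<odot>\<^bsub>M\<^esub> y\<close> by metis
    qed
  qed
  have good_add: "good (c + d)" if "good c" "good d" "c \<in> carrier ?G" "d \<in> carrier ?G" for c d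
  proof -
    obtain b b' where b: "b \<in> module_hom R ?F ?F" "b k = \<zero>\<^bsub>?F\<^esub>" "\<And>v. v \<in> carrier ?F \<Longrightarrow> p (b v) = h v c"
      and b': "b' \<in> module_hom R ?F ?F" "b' k = \<zero>\<^bsub>?F\<^esub>" "\<And>v. v \<in> carrier ?F \<Longrightarrow> p (b' v) = h v d"
      using \<open>good c\<close> \<open>good d\<close> unfolding good_def by blast
    show ?thesis unfolding good_def
    proof (intro bexI conjI ballI)
      show "(\<lambda>v. b v \<oplus>\<^bsub>?F\<^esub> b' v) \<in> module_hom R ?F ?F" by (rule module_hom_plus[OF F b(1) b'(1)])
      show "b k \<oplus>\<^bsub>?F\<^esub> b' k = \<zero>\<^bsub>?F\<^esub>" using b(2) b'(2) F.l_zero[OF F.zero_closed] by metis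
      show "p (b v \<oplus>\<^bsub>?F\<^esub> b' v) = h v (c + d)" if "v \<in> carrier ?F" for v
        using module_hom_add[OF p module_hom_closed[OF b(1) that] module_hom_closed[OF b'(1) that]]
          b(3) b'(3) that ha \<open>c \<in> carrier ?G\<close> \<open>d \<in> carrier ?G\<close> by simp
    qed
  qed
  have good_uminus: "good (- c)" if "good c" "c \<in> carrier ?G" for c
  proof -
    obtain b where b: "b \<in> module_hom R ?F ?F" "b k = \<zero>\<^bsub>?F\<^esub>" "\<And>v. v \<in> carrier ?F \<Longrightarrow> p (b v) = h v c"
      using \<open>good c\<close> unfolding good_def by blast
    have n: "\<ominus>\<^bsub>R\<^esub> \<one>\<^bsub>R\<^esub> \<in> carrier R" by simp
    show ?thesis unfolding good_def
    proof (intro bexI conjI ballI)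
      show "(\<lambda>v. \<ominus>\<^bsub>R\<^esub> \<one>\<^bsub>R\<^esub> \<odot>\<^bsub>?F\<^esub> b v) \<in> module_hom R ?F ?F" by (rule module_hom_scale[OF F b(1) n])
      show "\<ominus>\<^bsub>R\<^esub> \<one>\<^bsub>R\<^esub> \<odot>\<^bsub>?F\<^esub> b k = \<zero>\<^bsub>?F\<^esub>" using b(2) F.smult_r_null[OF n] by metis
      show "p (\<ominus>\<^bsub>R\<^esub> \<one>\<^bsub>R\<^esub> \<odot>\<^bsub>?F\<^esub> b v) = h v (- c)" if "v \<in> carrier ?F" for v
        using module_hom_smult[OF p n module_hom_closed[OF b(1) that]] b(3)[OF that]
          hi[OF that \<open>c \<in> carrier ?G\<close>] hc[OF that \<open>c \<in> carrier ?G\<close>] by (simp add: M.smult_l_minus)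
    qed
  qed
  define B where "B =
     ({frag_of (x \<oplus>\<^bsub>?I\<^esub> x', y) - frag_of (x, y) - frag_of (x', y) |x x' y.
         x \<in> carrier ?I \<and> x' \<in> carrier ?I \<and> y \<in> carrier M} \<union>
      {frag_of (x, y \<oplus>\<^bsub>M\<^esub> y') - frag_of (x, y) - frag_of (x, y') |x y y'.
         x \<in> carrier ?I \<and> y \<in> carrier M \<and> y' \<in> carrier M} \<union>
      {frag_of (a \<odot>\<^bsub>?I\<^esub> x, y) - frag_of (x, a \<odot>\<^bsub>M\<^esub> y) |a x y.
         a \<in> carrier R \<and> x \<in> carrier ?I \<and> y \<in> carrier M})"
  have BG: "B \<subseteq> carrier ?G" unfolding B_def by (rule tensor_relations_gens[OF Im M])
  have fc: "frag_of (a, y) \<in> carrier ?G" if "a \<in> I" "y \<in> carrier M" for a y using that by simp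
  have dc: "c - d \<in> carrier ?G" if "c \<in> carrier ?G" "d \<in> carrier ?G" for c d :: "'a \<times> 'b \<Rightarrow>\<^sub>0 int"
    using that keys_diff[of c d] by auto
  have hd2: "h v (c - d - e) = h v c \<ominus>\<^bsub>M\<^esub> h v d \<ominus>\<^bsub>M\<^esub> h v e"
    if "v \<in> carrier ?F" "c \<in> carrier ?G" "d \<in> carrier ?G" "e \<in> carrier ?G" for v c d e
    using hd[OF that(1) dc[OF that(2,3)] that(4)] hd[OF that(1,2,3)] by simp
  have goodB: "good c" if "c \<in> B" for c
    using that unfolding B_def
  proof (elim UnE CollectE exE conjE)
    fix x x' y
    assume c: "c = frag_of (x \<oplus>\<^bsub>?I\<^esub> x', y) - frag_of (x, y) - frag_of (x', y)"
      and "x \<in> carrier ?I" "x' \<in> carrier ?I" and y: "y \<in> carrier M"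
    then have x: "x \<in> I" "x' \<in> I" "x \<oplus>\<^bsub>R\<^esub> x' \<in> I" by simp_all
    show "good c"
    proof (rule goodI[OF _ _ y])
      show "(\<lambda>v. s (x \<oplus>\<^bsub>R\<^esub> x') v \<ominus>\<^bsub>R\<^esub> s x v \<ominus>\<^bsub>R\<^esub> s x' v) \<in> D"
        by (intro Dminus s x)
      show "s (x \<oplus>\<^bsub>R\<^esub> x') k \<ominus>\<^bsub>R\<^esub> s x k \<ominus>\<^bsub>R\<^esub> s x' k = \<zero>\<^bsub>R\<^esub>"
        using s(2) x I.a_Hcarr by (simp add: a_minus_def M.R.a_ac M.R.r_neg M.R.r_neg1 M.R.r_neg2)
      fix v assume v: "v \<in> carrier ?F"
      show "h v c = (s (x \<oplus>\<^bsub>R\<^esub> x') v \<ominus>\<^bsub>R\<^esub> s x v \<ominus>\<^bsub>R\<^esub> s x' v) \<odot>\<^bsub>M\<^esub> y"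
        using c x y v s(1) Dc[OF s(1) v]
        by (simp add: hd2[OF v fc fc fc] hf[OF v] a_minus_def M.smult_l_distr M.smult_l_minus)
    qed
  next
    fix x y y'
    assume c: "c = frag_of (x, y \<oplus>\<^bsub>M\<^esub> y') - frag_of (x, y) - frag_of (x, y')"
      and "x \<in> carrier ?I" and y: "y \<in> carrier M" "y' \<in> carrier M"
    then have x: "x \<in> I" by simp
    show "good c"
    \<comment> \<open>Additivity in the second argument holds without defect, so
      \<open>h v c\<close> is zero; the zero form is written as a difference because
      \<open>D\<close> is known to be closed under differences.\<close>
    proof (rule goodI[OF _ _ M.zero_closed])
      show "(\<lambda>v. s x v \<ominus>\<^bsub>R\<^esub> s x v) \<in> D" by (intro Dminus s x)
      show "s x k \<ominus>\<^bsub>R\<^esub> s x k = \<zero>\<^bsub>R\<^esub>"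
        using s(2) x I.a_Hcarr by (simp add: a_minus_def M.R.r_neg)
      fix v assume v: "v \<in> carrier ?F"
      show "h v c = (s x v \<ominus>\<^bsub>R\<^esub> s x v) \<odot>\<^bsub>M\<^esub> \<zero>\<^bsub>M\<^esub>"
        using c x y v s(1) Dc[OF s(1) v]
        by (simp add: hd2[OF v fc fc fc] hf[OF v] a_minus_def M.smult_r_distr M.a_ac M.minus_add M.r_neg M.r_neg1 M.r_neg2)
    qed
  next
    fix a x y
    assume c: "c = frag_of (a \<odot>\<^bsub>?I\<^esub> x, y) - frag_of (x, a \<odot>\<^bsub>M\<^esub> y)"
      and a: "a \<in> carrier R" and "x \<in> carrier ?I" and y: "y \<in> carrier M"
    then have x: "x \<in> I" "a \<otimes>\<^bsub>R\<^esub> x \<in> I" using I.I_l_closed by simp_all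
    show "good c"
    proof (rule goodI[OF _ _ y])
      show "(\<lambda>v. s (a \<otimes>\<^bsub>R\<^esub> x) v \<ominus>\<^bsub>R\<^esub> a \<otimes>\<^bsub>R\<^esub> s x v) \<in> D"
        by (intro Dminus Dscale s x a)
      show "s (a \<otimes>\<^bsub>R\<^esub> x) k \<ominus>\<^bsub>R\<^esub> a \<otimes>\<^bsub>R\<^esub> s x k = \<zero>\<^bsub>R\<^esub>"
        using s(2) x a I.a_Hcarr by (simp add: a_minus_def M.R.r_neg)
      fix v assume v: "v \<in> carrier ?F"
      have "s x v \<odot>\<^bsub>M\<^esub> (a \<odot>\<^bsub>M\<^esub> y) = (a \<otimes>\<^bsub>R\<^esub> s x v) \<odot>\<^bsub>M\<^esub> y"
        using M.smult_assoc1[of "s x v" a y] a y Dc[OF s(1) v] x by (simp add: M.m_comm)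
      then show "h v c = (s (a \<otimes>\<^bsub>R\<^esub> x) v \<ominus>\<^bsub>R\<^esub> a \<otimes>\<^bsub>R\<^esub> s x v) \<odot>\<^bsub>M\<^esub> y"
        using c x y v a s(1) Dc[OF s(1) v]
        by (simp add: hd[OF v fc fc] hf[OF v] a_minus_def M.smult_l_distr M.smult_l_minus)
    qed
  qed
  have "r \<in> generate ?G B" using r unfolding tensor_relations_def B_def .
  moreover have "c \<in> carrier ?G" if "c \<in> generate ?G B" for c
    using group.generate_in_carrier[OF group_free_Abelian_group BG that] .
  moreover have "good c" if "c \<in> generate ?G B" for c
    using that
  proof (induction rule: generate.induct)
    case one
    show ?case
      using goodI[OF Dminus[OF s(1) s(1)] _ M.zero_closed, OF Iz Iz] hz Dc[OF s(1)] s(2) Iz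
      by (simp add: a_minus_def M.R.r_neg)
  next
    case (incl c) then show ?case by (rule goodB)
  next
    case (inv c)
    then have "c \<in> carrier ?G" using BG by blast
    then show ?case using good_uminus[OF goodB[OF inv]] by simp
  next
    case (eng c d)
    then show ?case
      using good_add group.generate_in_carrier[OF group_free_Abelian_group BG] by simp
  qed
  ultimately obtain b where b: "b \<in> module_hom R ?F ?F" "b k = \<zero>\<^bsub>?F\<^esub>"
    and pb: "\<And>v. v \<in> carrier ?F \<Longrightarrow> p (b v) = h v r" and rG: "r \<in> carrier ?G"
    unfolding good_def by blast
  \<comment> \<open>The forms chosen for the coordinates of \<open>k\<close>, assembled into an
    endomorphism. It fixes \<open>k\<close>, since \<open>s a\<close> takes the value
    \<open>a\<close> at \<open>k\<close>, and \<open>p (g v)\<close> is \<open>h v r\<close>, since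
    \<open>r\<close> pairs each coordinate with the image of its unit vector.\<close>
  define g where "g v = (\<lambda>x\<in>X. s (k x) v)" for v
  have kx: "k x \<in> I" if "x \<in> X" for x using kI that by blast
  have g: "g \<in> module_hom R ?F ?F"
  proof (rule module_homI)
    fix v assume v: "v \<in> carrier ?F"
    then show "g v \<in> carrier ?F" using Dc[OF s(1)[OF kx]] by (auto simp: g_def)
    fix w assume w: "w \<in> carrier ?F"
    show "g (v \<oplus>\<^bsub>?F\<^esub> w) = g v \<oplus>\<^bsub>?F\<^esub> g w"
      using module_hom_add[of _ R ?F ?S v w] s(1)[OF kx] v w
      by (auto simp: g_def D_def intro!: restrict_ext)
  next
    fix a v assume "a \<in> carrier R" "v \<in> carrier ?F"
    then show "g (a \<odot>\<^bsub>?F\<^esub> v) = a \<odot>\<^bsub>?F\<^esub> g v"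
      using module_hom_smult[of _ R ?F ?S a v] s(1)[OF kx]
      by (auto simp: g_def D_def intro!: restrict_ext)
  qed
  have gk: "g k = k"
    using k(1) s(2) kx by (auto simp: g_def intro!: PiE_ext[of _ X "\<lambda>_. carrier R"] simp: coord_closed)
  have pg: "p (g v) = h v r" if v: "v \<in> carrier ?F" for v
  proof -
    have sm: "s (k x) v \<odot>\<^bsub>M\<^esub> m x \<in> carrier M" if "x \<in> X" for x
      using mc that by (intro M.smult_closed Dc[OF s(1)[OF kx[OF that]] v]) auto
    have "finite Y \<Longrightarrow> Y \<subseteq> X \<Longrightarrow> h v (\<Sum>x\<in>Y. frag_of (k x, m x)) = (\<Oplus>\<^bsub>M\<^esub>x\<in>Y. s (k x) v \<odot>\<^bsub>M\<^esub> m x)" for Y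
    proof (induction Y rule: finite_induct)
      case empty then show ?case using hz[OF v] by simp
    next
      case (insert x Y)
      have x: "k x \<in> I" "m x \<in> carrier M" using insert.prems kx mc by auto
      have "(\<Sum>x\<in>Y. frag_of (k x, m x)) \<in> carrier ?G"
        using insert.prems kx mc by (intro sum_closed_free_Abelian_group fc) auto
      moreover have "(\<lambda>x. s (k x) v \<odot>\<^bsub>M\<^esub> m x) \<in> Y \<rightarrow> carrier M"
        using insert.prems sm by auto
      ultimately show ?case
        using insert x Dc[OF s(1) v] ha[OF v fc[OF x]] hf[OF v x] by simp
    qed
    from this[OF X order.refl] have "h v r = (\<Oplus>\<^bsub>M\<^esub>x\<in>X. s (k x) v \<odot>\<^bsub>M\<^esub> m x)" by (simp add: r_def)
    also have "\<dots> = lincomb M X m (g v)"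
      unfolding lincomb_def g_def
      using sm by (intro M.finsum_cong') auto
    finally show ?thesis using pl[OF module_hom_closed[OF g v]] by simp
  qed
  show ?thesis
  proof (rule that)
    \<comment> \<open>The map \<open>1 - g + b\<close>: at \<open>k\<close> the first two terms
      cancel and \<open>b\<close> vanishes, while \<open>p g\<close> and \<open>p b\<close> are both
      \<open>h _ r\<close>, so that \<open>p\<close> is unchanged.\<close>
    show "(\<lambda>v. v \<ominus>\<^bsub>?F\<^esub> g v \<oplus>\<^bsub>?F\<^esub> b v) \<in> module_hom R ?F ?F"
      by (intro module_hom_plus[OF F] module_hom_minus[OF F] module_hom_ident g b)
    show "k \<ominus>\<^bsub>?F\<^esub> g k \<oplus>\<^bsub>?F\<^esub> b k = \<zero>\<^bsub>?F\<^esub>"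
      using k(1) b(2) gk F.r_neg F.l_zero[OF F.zero_closed] by (metis a_minus_def)
    fix v assume v: "v \<in> carrier ?F"
    note c = module_hom_closed[OF g v] module_hom_closed[OF b(1) v]
    have "p (v \<ominus>\<^bsub>?F\<^esub> g v \<oplus>\<^bsub>?F\<^esub> b v) = p v \<ominus>\<^bsub>M\<^esub> h v r \<oplus>\<^bsub>M\<^esub> h v r"
      using module_hom_add[OF p F.minus_closed[OF v c(1)] c(2)] module_hom_diff[OF F M p v c(1)]
        pg[OF v] pb[OF v] by simp
    also have "\<dots> = p v"
      using module_hom_closed[OF p v] hc[OF v rG] by (simp add: a_minus_def M.a_assoc M.l_neg)
    finally show "p (v \<ominus>\<^bsub>?F\<^esub> g v \<oplus>\<^bsub>?F\<^esub> b v) = p v" .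
  qed
qed

subsection \<open>Lifting a splitting from the quotient\<close>

text \<open>If \<open>b\<close> lies over \<open>M\<close> and kills \<open>Z\<close>, then
  \<open>b z\<close> is again a relation; an endomorphism over \<open>M\<close> that kills
  \<open>b z\<close> is composed with \<open>b\<close>.\<close>

lemma flat_module_kill_relations:
  fixes X :: "'i set" and M :: "('a, 'b, 'm) module_scheme"
  assumes M: "module R M" and flat: "flat_module TYPE('a) R M" and X: "finite X"
    and p: "p \<in> module_hom R (free_mod R X) M" and surj: "p ` carrier (free_mod R X) = carrier M"
    and Z: "finite Z" "Z \<subseteq> carrier (free_mod R X)" "\<And>z. z \<in> Z \<Longrightarrow> p z = \<zero>\<^bsub>M\<^esub>"
  shows "\<exists>b\<in>module_hom R (free_mod R X) (free_mod R X).
    (\<forall>v\<in>carrier (free_mod R X). p (b v) = p v) \<and> (\<forall>z\<in>Z. b z = \<zero>\<^bsub>free_mod R X\<^esub>)"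
  using Z
proof (induction Z rule: finite_induct)
  case empty
  show ?case by (intro bexI[of _ "\<lambda>v. v"] module_hom_ident) auto
next
  case (insert z Z)
  interpret M: module R M by fact
  let ?F = "free_mod R X"
  have F: "module R ?F" by (rule module_free_mod[OF M.is_cring])
  have "\<exists>b\<in>module_hom R ?F ?F. (\<forall>v\<in>carrier ?F. p (b v) = p v) \<and> (\<forall>z\<in>Z. b z = \<zero>\<^bsub>?F\<^esub>)"
    using insert.prems by (intro insert.IH) blast+
  then obtain b where b: "b \<in> module_hom R ?F ?F"
    "\<And>v. v \<in> carrier ?F \<Longrightarrow> p (b v) = p v" "\<And>z. z \<in> Z \<Longrightarrow> b z = \<zero>\<^bsub>?F\<^esub>"
    by blast
  have z: "z \<in> carrier ?F" "p z = \<zero>\<^bsub>M\<^esub>" using insert.prems by blast+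
  have bz: "b z \<in> carrier ?F" "p (b z) = \<zero>\<^bsub>M\<^esub>" using z b module_hom_closed by (metis, metis)
  obtain c where c: "c \<in> module_hom R ?F ?F"
    "\<And>v. v \<in> carrier ?F \<Longrightarrow> p (c v) = p v" "c (b z) = \<zero>\<^bsub>?F\<^esub>"
    using flat_module_kill_relation[OF M flat X p surj bz] by blast
  show ?case
  proof (intro bexI conjI ballI)
    show "(\<lambda>v. c (b v)) \<in> module_hom R ?F ?F" by (rule module_hom_comp[OF b(1) c(1)])
    show "p (c (b v)) = p v" if "v \<in> carrier ?F" for v
      using c(2)[OF module_hom_closed[OF b(1) that]] b(2)[OF that] by simp
    show "c (b y) = \<zero>\<^bsub>?F\<^esub>" if "y \<in> insert z Z" for y
    proof (cases "y = z")
      case True then show ?thesis using c(3) by simp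
    next
      case False
      then have "b y = \<zero>\<^bsub>?F\<^esub>" using that b(3) by blast
      then show ?thesis using module_hom_zero[OF F F c(1)] by simp
    qed
  qed
qed

section \<open>Restriction of scalars along the reduction from \<open>R\<close> to
  \<open>R/J\<close>\<close>

definition restrict_scalars ::
  "('a, 'r) ring_scheme \<Rightarrow> 'a set \<Rightarrow> ('a set, 'b, 'n) module_scheme \<Rightarrow> ('a, 'b) module"
  where "restrict_scalars R J N =
    \<lparr>carrier = carrier N, monoid.mult = undefined, monoid.one = undefined,
     ring.zero = ring.zero N, ring.add = ring.add N, smult = (\<lambda>a x. (J +>\<^bsub>R\<^esub> a) \<odot>\<^bsub>N\<^esub> x)\<rparr>"

lemma restrict_scalars_simps [simp]:
  "carrier (restrict_scalars R J N) = carrier N"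
  "ring.zero (restrict_scalars R J N) = ring.zero N"
  "ring.add (restrict_scalars R J N) = ring.add N"
  "a \<odot>\<^bsub>restrict_scalars R J N\<^esub> x = (J +>\<^bsub>R\<^esub> a) \<odot>\<^bsub>N\<^esub> x"
  by (simp_all add: restrict_scalars_def)

context ideal
begin

lemma Quot_simps:
  shows "a \<in> carrier R \<Longrightarrow> I +> a \<in> carrier (R Quot I)"
    and "a \<in> carrier R \<Longrightarrow> b \<in> carrier R \<Longrightarrow> (I +> a) \<oplus>\<^bsub>R Quot I\<^esub> (I +> b) = I +> (a \<oplus> b)"
    and "a \<in> carrier R \<Longrightarrow> b \<in> carrier R \<Longrightarrow> (I +> a) \<otimes>\<^bsub>R Quot I\<^esub> (I +> b) = I +> (a \<otimes> b)"
    and "\<one>\<^bsub>R Quot I\<^esub> = I +> \<one>" and "\<zero>\<^bsub>R Quot I\<^esub> = I"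
  using a_rcos_sum rcoset_mult_add by (auto simp: FactRing_def A_RCOSETS_def')

lemma carrier_QuotE:
  assumes "A \<in> carrier (R Quot I)" obtains a where "a \<in> carrier R" "A = I +> a"
  using assms by (auto simp: FactRing_def A_RCOSETS_def')

lemma rcoset_eq_ideal_iff: "a \<in> carrier R \<Longrightarrow> I +> a = I \<longleftrightarrow> a \<in> I"
  using a_rcos_const a_rcos_self by blast

lemma module_restrict_scalars:
  assumes "cring R" "module (R Quot I) N"
  shows "module R (restrict_scalars R I N)"
proof -
  interpret N: module "R Quot I" N by fact
  show ?thesis
  proof (rule moduleI)
    show "abelian_group (restrict_scalars R I N)"
      by (rule abelian_groupI) (auto simp: N.a_ac intro: N.l_neg)
    fix a b x assume "a \<in> carrier R" "b \<in> carrier R" and x: "x \<in> carrier (restrict_scalars R I N)"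
    then show "(a \<oplus> b) \<odot>\<^bsub>restrict_scalars R I N\<^esub> x
        = a \<odot>\<^bsub>restrict_scalars R I N\<^esub> x \<oplus>\<^bsub>restrict_scalars R I N\<^esub> b \<odot>\<^bsub>restrict_scalars R I N\<^esub> x"
      and "(a \<otimes> b) \<odot>\<^bsub>restrict_scalars R I N\<^esub> x
        = a \<odot>\<^bsub>restrict_scalars R I N\<^esub> (b \<odot>\<^bsub>restrict_scalars R I N\<^esub> x)"
      using N.smult_l_distr[of "I +> a" "I +> b" x] N.smult_assoc1[of "I +> a" "I +> b" x]
      by (simp_all add: Quot_simps)
  next
    fix x assume "x \<in> carrier (restrict_scalars R I N)"
    then show "\<one> \<odot>\<^bsub>restrict_scalars R I N\<^esub> x = x" using N.smult_one[of x] by (simp add: Quot_simps)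
  qed (use assms(1) in \<open>auto simp: Quot_simps N.smult_r_distr\<close>)
qed

lemma module_hom_restrict_scalars:
  assumes "f \<in> module_hom (R Quot I) N L"
  shows "f \<in> module_hom R (restrict_scalars R I N) (restrict_scalars R I L)"
  using assms by (auto simp: module_hom_def Quot_simps)

text \<open>The reindexing \<open>t\<close> is there because the free modules over \<open>R\<close>
  and over \<open>R/J\<close> will have different index types.\<close>

lemma free_mod_reduction_hom:
  "(\<lambda>v. \<lambda>y\<in>Y. I +> v (t y)) \<in> module_hom R (free_mod R X) (restrict_scalars R I (free_mod (R Quot I) Y))"
  if "t ` Y \<subseteq> X"
  using that
  by (intro module_homI) (auto simp: Quot_simps coord_closed intro!: restrict_ext)

end

lemma (in module) quotient_module_proj_hom:
  assumes "ideal J R"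
  shows "(\<lambda>x. ideal_smult R M J +>\<^bsub>M\<^esub> x) \<in> module_hom R M (restrict_scalars R J (quotient_module R M J))"
proof -
  have sub: "submodule (ideal_smult R M J) R M" by (rule ideal_smult_submodule[OF assms])
  interpret H: abelian_subgroup "ideal_smult R M J" M
    by (rule abelian_subgroupI3)
      (use sub in \<open>auto simp: additive_subgroup_def submodule_def M.abelian_group_axioms\<close>)
  show ?thesis
    by (rule module_homI)
      (use H.a_rcos_sum quotient_smult_coset[OF assms] in \<open>auto simp: quotient_module_def A_RCOSETS_def'\<close>)
qed

section \<open>Submodules under homomorphisms\<close>

lemma (in module) zero_submodule: "submodule {\<zero>\<^bsub>M\<^esub>} R M"
  by (rule submoduleI) auto

lemma (in module) submodule_vimage:
  assumes "module R N" "f \<in> module_hom R M N" "submodule P R N"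
  shows "submodule {x \<in> carrier M. f x \<in> P} R M"
proof -
  interpret N: module R N by fact
  show ?thesis
    using assms(2) N.submoduleE(3-5)[OF assms(3)]
    by (intro submoduleI)
      (auto simp: module_hom_zero[OF module_axioms assms(1)] N.submodule_zero_closed[OF assms(3)]
        module_hom_a_inv[OF module_axioms assms(1)] module_hom_add module_hom_smult)
qed

lemma (in module) submodule_image:
  assumes N: "module R N" and f: "f \<in> module_hom R M N" and P: "submodule P R M"
  shows "submodule (f ` P) R N"
proof -
  interpret N: module R N by fact
  have Pc: "x \<in> carrier M" if "x \<in> P" for x using submoduleE(1)[OF P] that by auto
  show ?thesis
  proof (rule N.submoduleI)
    show "f ` P \<subseteq> carrier N" using Pc module_hom_closed[OF f] by auto
    show "\<zero>\<^bsub>N\<^esub> \<in> f ` P"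
      using module_hom_zero[OF module_axioms N f] submodule_zero_closed[OF P] by (metis imageI)
    show "\<ominus>\<^bsub>N\<^esub> y \<in> f ` P" if "y \<in> f ` P" for y
      using that module_hom_a_inv[OF module_axioms N f Pc, symmetric] submoduleE(3)[OF P] by auto
    show "y \<oplus>\<^bsub>N\<^esub> z \<in> f ` P" if "y \<in> f ` P" "z \<in> f ` P" for y z
      using that module_hom_add[OF f Pc Pc, symmetric] submoduleE(5)[OF P] by auto
    show "a \<odot>\<^bsub>N\<^esub> y \<in> f ` P" if "a \<in> carrier R" "y \<in> f ` P" for a y
      using that module_hom_smult[OF f that(1) Pc, symmetric] submoduleE(4)[OF P] by auto
  qed
qed

lemma (in module) module_span_subset:
  "submodule P R M \<Longrightarrow> S \<subseteq> P \<Longrightarrow> module_span R M S \<subseteq> P"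
  by (auto simp: module_span_def)

lemma (in module) ideal_smult_subset:
  "submodule P R M \<Longrightarrow> (\<And>a x. a \<in> J \<Longrightarrow> x \<in> carrier M \<Longrightarrow> a \<odot>\<^bsub>M\<^esub> x \<in> P) \<Longrightarrow> ideal_smult R M J \<subseteq> P"
  unfolding ideal_smult_def by (rule module_span_subset) auto

text \<open>Elements of \<open>J M\<close> lift into \<open>J L\<close>. This allows a lift to be
  corrected without any change of its reduction modulo \<open>J\<close>.\<close>

lemma (in module) ideal_smult_image:
  assumes J: "ideal J R" and L: "module R L" and p: "p \<in> module_hom R L M" "p ` carrier L = carrier M"
  shows "ideal_smult R M J \<subseteq> p ` ideal_smult R L J"
proof -
  interpret L: module R L by fact
  interpret J: ideal J R by fact
  show ?thesis
  proof (rule ideal_smult_subset[OF L.submodule_image[OF module_axioms p(1) L.ideal_smult_submodule[OF J]]])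
    fix a x assume a: "a \<in> J" and "x \<in> carrier M"
    then have "x \<in> p ` carrier L" using p(2) by simp
    then obtain y where y: "y \<in> carrier L" "x = p y" by (elim imageE) simp
    then have "a \<odot>\<^bsub>M\<^esub> x = p (a \<odot>\<^bsub>L\<^esub> y)"
      using module_hom_smult[OF p(1)] a J.a_Hcarr by simp
    then show "a \<odot>\<^bsub>M\<^esub> x \<in> p ` ideal_smult R L J" using L.ideal_smult_mem[OF a y(1)] by simp
  qed
qed

text \<open>With \<open>q : F \<rightarrow> (R/J)^Y\<close> the reduction of coordinates,
  \<open>c : M \<rightarrow> M/JM\<close> the projection and \<open>h\<close> a splitting of
  \<open>(R/J)^Y \<rightarrow> M/JM\<close>, the map \<open>b\<close> is prescribed on the basis so
  that \<open>p b = p\<close> and \<open>q b = h c p\<close> hold together. Where \<open>p\<close>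
  vanishes, the second equation gives \<open>q b = 0\<close>, which says that all coordinates lie in
  \<open>J\<close>.\<close>

lemma projective_quotient_lift:
  fixes X :: "'b set" and M :: "('a, 'b, 'm) module_scheme"
  assumes M: "module R M" and J: "ideal J R"
    and proj: "projective_module TYPE('b set \<Rightarrow> 'a set) TYPE('b set) (R Quot J) (quotient_module R M J)"
    and X: "finite X"
    and p: "p \<in> module_hom R (free_mod R X) M" and surj: "p ` carrier (free_mod R X) = carrier M"
  obtains b where "b \<in> module_hom R (free_mod R X) (free_mod R X)"
    "\<And>v. v \<in> carrier (free_mod R X) \<Longrightarrow> p (b v) = p v"
    "\<And>v. v \<in> carrier (free_mod R X) \<Longrightarrow> p v = \<zero>\<^bsub>M\<^esub> \<Longrightarrow> b v \<in> ideal_smult R (free_mod R X) J"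
proof -
  interpret M: module R M by fact
  interpret J: ideal J R by fact
  let ?F = "free_mod R X" and ?H = "ideal_smult R M J" and ?Q = "quotient_module R M J"
  let ?S = "R Quot J"
  let ?e = "unit_vec R X"
  have F: "module R ?F" by (rule module_free_mod[OF M.is_cring])
  interpret F: module R ?F by (rule F)
  have Sc: "cring ?S" by (rule J.quotient_is_cring[OF M.is_cring])
  interpret S: cring ?S by (rule Sc)
  have Q: "module ?S ?Q" by (rule M.quotient_module_is_module[OF J])
  interpret Q: module ?S ?Q by (rule Q)
  \<comment> \<open>Indexing by singletons puts the free module into the type of test modules.\<close>
  define Y where "Y = (\<lambda>x. {x}) ` X"
  have Y: "finite Y" using X by (simp add: Y_def)
  let ?N = "free_mod ?S Y"
  have N: "module ?S ?N" by (rule module_free_mod[OF Sc])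
  let ?N' = "restrict_scalars R J ?N" and ?Q' = "restrict_scalars R J ?Q"
  have N': "module R ?N'" and Q': "module R ?Q'"
    using J.module_restrict_scalars[OF M.is_cring] N Q by blast+
  interpret N': module R ?N' by (rule N')
  define c where "c m = ?H +>\<^bsub>M\<^esub> m" for m
  have c: "c \<in> module_hom R M ?Q'" unfolding c_def by (rule M.quotient_module_proj_hom[OF J])
  define q where "q = (\<lambda>v::'b \<Rightarrow> 'a. \<lambda>y\<in>Y. J +>\<^bsub>R\<^esub> v (the_elem y))"
  have q: "q \<in> module_hom R ?F ?N'"
    unfolding q_def by (rule J.free_mod_reduction_hom) (auto simp: Y_def)
  have q_surj: "\<exists>v\<in>carrier ?F. q v = w" if w: "w \<in> carrier ?N" for w
  proof -
    have "\<exists>a\<in>carrier R. w {x} = J +>\<^bsub>R\<^esub> a" if "x \<in> X" for x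
    proof -
      have "w {x} \<in> carrier ?S" using w that coord_closed[of w Y ?S "{x}"] by (simp add: Y_def)
      then show ?thesis by (rule J.carrier_QuotE) blast
    qed
    then obtain a where a: "\<And>x. x \<in> X \<Longrightarrow> a x \<in> carrier R" "\<And>x. x \<in> X \<Longrightarrow> w {x} = J +>\<^bsub>R\<^esub> a x" by metis
    have "q (restrict a X) = w"
    proof (rule PiE_ext[of _ Y "\<lambda>_. carrier ?S"])
      show "q (restrict a X) \<in> Y \<rightarrow>\<^sub>E carrier ?S"
        using a(1) J.Quot_simps(1) by (auto simp: q_def Y_def)
    qed (use w a(2) in \<open>auto simp: q_def Y_def\<close>)
    then show ?thesis using a(1) by (intro bexI[of _ "restrict a X"]) auto
  qed
  define g where "g = lincomb ?Q Y (\<lambda>y. c (p (?e (the_elem y))))"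
  have pe: "p (?e x) \<in> carrier M" for x by (rule module_hom_closed[OF p M.unit_vec_closed])
  have cQ: "c m \<in> carrier ?Q" if "m \<in> carrier M" for m using module_hom_closed[OF c that] by simp
  have g: "g \<in> module_hom ?S ?N ?Q"
    unfolding g_def using cQ pe by (intro S.lincomb_hom[OF Q]) auto
  \<comment> \<open>The square formed by \<open>p\<close>, \<open>c\<close>, \<open>q\<close> and
    \<open>g\<close> commutes. Its corners \<open>F\<close> and \<open>M/JM\<close> are compared
    over \<open>R\<close>, so that equality on the unit vectors of \<open>F\<close>
    suffices.\<close>
  have gq: "g (q v) = c (p v)" if v: "v \<in> carrier ?F" for v
  proof (rule M.free_mod_hom_ext[OF Q' X _ _ _ v])
    show "(\<lambda>v. g (q v)) \<in> module_hom R ?F ?Q'"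
      by (rule module_hom_comp[OF q J.module_hom_restrict_scalars[OF g]])
    show "(\<lambda>v. c (p v)) \<in> module_hom R ?F ?Q'" by (rule module_hom_comp[OF p c])
    fix x assume x: "x \<in> X"
    have "q (?e x) = unit_vec ?S Y {x}"
    proof (rule PiE_ext[of _ Y "\<lambda>_. carrier ?S"])
      show "q (?e x) \<in> Y \<rightarrow>\<^sub>E carrier ?S"
        using module_hom_closed[OF q M.unit_vec_closed[of X x]] by simp
      show "unit_vec ?S Y {x} \<in> Y \<rightarrow>\<^sub>E carrier ?S" using S.unit_vec_closed[of Y "{x}"] by simp
      fix y assume "y \<in> Y"
      then obtain z where "z \<in> X" "y = {z}" "y \<in> Y" by (auto simp: Y_def)
      then show "q (?e x) y = unit_vec ?S Y {x} y"
        by (auto simp: q_def unit_vec_def J.Quot_simps(4,5) J.rcoset_eq_ideal_iff)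
    qed
    then show "g (q (?e x)) = c (p (?e x))"
      unfolding g_def using S.lincomb_of_unit_vec[OF Q Y, of "\<lambda>y. c (p (?e (the_elem y)))" "{x}"] cQ pe x
      by (simp add: Y_def)
  qed
  have "g ` carrier ?N = carrier ?Q"
  proof
    show "g ` carrier ?N \<subseteq> carrier ?Q" using module_hom_closed[OF g] by blast
    show "carrier ?Q \<subseteq> g ` carrier ?N"
    proof
      fix U assume "U \<in> carrier ?Q"
      then obtain m where m: "m \<in> carrier M" "U = c m"
        by (auto simp: quotient_module_def A_RCOSETS_def' c_def)
      then have "m \<in> p ` carrier ?F" using surj by simp
      then obtain v where v: "v \<in> carrier ?F" "m = p v" by (elim imageE) simp
      then have "U = g (q v)" using gq m by simp
      moreover have "q v \<in> carrier ?N" using module_hom_closed[OF q v(1)] by simp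
      ultimately show "U \<in> g ` carrier ?N" by blast
    qed
  qed
  then have "\<exists>h\<in>module_hom ?S ?Q ?N. \<forall>U\<in>carrier ?Q. g (h U) = U"
    using proj[unfolded projective_module_def, rule_format, OF N Q g _ module_hom_ident] by simp
  then obtain h where h: "h \<in> module_hom ?S ?Q ?N" and gh: "\<And>U. U \<in> carrier ?Q \<Longrightarrow> g (h U) = U"
    by (elim bexE) simp
  have h': "h \<in> module_hom R ?Q' ?N'" by (rule J.module_hom_restrict_scalars[OF h])
  have qJ: "q w = \<zero>\<^bsub>?N\<^esub>" if "w \<in> ideal_smult R ?F J" for w
  proof -
    have z: "submodule {\<zero>\<^bsub>?N'\<^esub>} R ?N'" by (rule N'.zero_submodule)
    have "ideal_smult R ?F J \<subseteq> {v \<in> carrier ?F. q v \<in> {\<zero>\<^bsub>?N'\<^esub>}}"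
    proof (rule F.ideal_smult_subset[OF F.submodule_vimage[OF N' q z]])
      fix a v assume a: "a \<in> J" and v: "v \<in> carrier ?F"
      have aR: "a \<in> carrier R" using a J.a_Hcarr by blast
      have qv: "q v \<in> carrier ?N" using module_hom_closed[OF q v] by simp
      have "q (a \<odot>\<^bsub>?F\<^esub> v) = (J +>\<^bsub>R\<^esub> a) \<odot>\<^bsub>?N\<^esub> q v" using module_hom_smult[OF q aR v] by simp
      also have "J +>\<^bsub>R\<^esub> a = \<zero>\<^bsub>?S\<^esub>" using a J.a_rcos_const J.Quot_simps(5) by simp
      also have "\<zero>\<^bsub>?S\<^esub> \<odot>\<^bsub>?N\<^esub> q v = \<zero>\<^bsub>?N\<^esub>" by (rule module.smult_l_null[OF N qv])
      finally show "a \<odot>\<^bsub>?F\<^esub> v \<in> {v \<in> carrier ?F. q v \<in> {\<zero>\<^bsub>?N'\<^esub>}}"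
        using F.smult_closed[OF aR v] by (simp del: free_mod_simps)
    qed
    then show ?thesis using that by (auto simp del: free_mod_simps)
  qed
  \<comment> \<open>Any \<open>d\<close> with \<open>q d = h (c m)\<close> satisfies
    \<open>c (p d) = g (h (c m)) = c m\<close>, so \<open>m - p d\<close> lies in
    \<open>J M\<close>. It lifts to some \<open>j\<close> in \<open>J F\<close>; adding
    \<open>j\<close> repairs the value under \<open>p\<close>, and \<open>q\<close> does not see
    it.\<close>
  have "\<exists>d\<in>carrier ?F. p d = p (?e x) \<and> q d = h (c (p (?e x)))" for x
  proof -
    let ?m = "p (?e x)"
    have "h (c ?m) \<in> carrier ?N" using module_hom_closed[OF h cQ[OF pe]] .
    then obtain d where d: "d \<in> carrier ?F" "q d = h (c ?m)" using q_surj by blast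
    have pd: "p d \<in> carrier M" by (rule module_hom_closed[OF p d(1)])
    have "c (p d) = c ?m" using gq[OF d(1)] d(2) gh[OF cQ[OF pe]] by simp
    then have "?m \<ominus>\<^bsub>M\<^esub> p d \<in> ?H"
    proof -
      have sub: "subgroup ?H (add_monoid M)" using M.ideal_smult_submodule[OF J] by (simp add: submodule_def)
      have "?H +>\<^bsub>M\<^esub> (?m \<ominus>\<^bsub>M\<^esub> p d) = ?H"
        using M.a_coset_add_inv2[OF _ pe pd] M.submoduleE(1)[OF M.ideal_smult_submodule[OF J]]
          \<open>c (p d) = c ?m\<close> by (simp add: c_def a_minus_def)
      then show ?thesis using M.a_coset_join1 pe pd sub by simp
    qed
    then obtain j where j: "j \<in> ideal_smult R ?F J" "?m \<ominus>\<^bsub>M\<^esub> p d = p j"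
      using M.ideal_smult_image[OF J F p surj] by blast
    have jc: "j \<in> carrier ?F" using j(1) F.submoduleE(1)[OF F.ideal_smult_submodule[OF J]] by blast
    show ?thesis
    proof (intro bexI conjI)
      show "d \<oplus>\<^bsub>?F\<^esub> j \<in> carrier ?F" by (rule F.a_closed[OF d(1) jc])
      show "p (d \<oplus>\<^bsub>?F\<^esub> j) = ?m"
        using module_hom_add[OF p d(1) jc] j(2)[symmetric] pe[of x] pd
        by (simp add: a_minus_def M.a_ac M.r_neg M.r_neg1 M.r_neg2)
      show "q (d \<oplus>\<^bsub>?F\<^esub> j) = h (c ?m)"
        using module_hom_add[OF q d(1) jc] qJ[OF j(1)] d(2) N'.r_zero[OF module_hom_closed[OF q d(1)]]
        by simp
    qed
  qed
  then obtain d where d: "\<And>x. d x \<in> carrier ?F" "\<And>x. p (d x) = p (?e x)" "\<And>x. q (d x) = h (c (p (?e x)))"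
    by metis
  define b where "b = lincomb ?F X d"
  have b: "b \<in> module_hom R ?F ?F" unfolding b_def using d(1) by (intro M.lincomb_hom[OF F]) auto
  have be: "b (?e x) = d x" if "x \<in> X" for x
    unfolding b_def using d(1) that by (intro M.lincomb_of_unit_vec[OF F X]) auto
  show ?thesis
  proof (rule that[OF b])
    fix v assume v: "v \<in> carrier ?F"
    show "p (b v) = p v"
      by (rule M.free_mod_hom_ext[OF M X module_hom_comp[OF b p] p _ v]) (simp add: be d(2))
    have qb: "q (b v) = h (c (p v))"
      by (rule M.free_mod_hom_ext[OF N' X module_hom_comp[OF b q]
            module_hom_comp[OF module_hom_comp[OF p c] h'] _ v]) (simp add: be d(3))
    assume "p v = \<zero>\<^bsub>M\<^esub>"
    then have qz: "q (b v) = \<zero>\<^bsub>?N\<^esub>"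
      using qb module_hom_zero[OF M Q' c] module_hom_zero[OF Q' N' h'] by simp
    have bv: "b v \<in> carrier ?F" by (rule module_hom_closed[OF b v])
    show "b v \<in> ideal_smult R ?F J"
    proof (rule M.free_mod_ideal_smultI[OF X J bv])
      fix x assume x: "x \<in> X"
      then have y: "{x} \<in> Y" by (simp add: Y_def)
      have "J +>\<^bsub>R\<^esub> b v x = J" using fun_cong[OF qz, of "{x}"] y by (simp add: q_def J.Quot_simps(5))
      moreover have "b v x \<in> carrier R" using bv x coord_closed[of "b v" X R x] by simp
      ultimately show "b v x \<in> J" using J.rcoset_eq_ideal_iff by blast
    qed
  qed
qed

subsection \<open>Descent of projectivity\<close>

lemma (in abelian_group) minus_eq_zeroD:
  assumes "x \<in> carrier G" "y \<in> carrier G" "x \<ominus> y = \<zero>"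
  shows "x = y"
proof -
  have "(x \<ominus> y) \<oplus> y = x" using assms(1,2) by (simp add: minus_eq a_assoc l_neg)
  then show ?thesis using assms by simp
qed

text \<open>Such an \<open>a\<close> amounts to a section of \<open>p\<close>: vanishing on the
  kernel it factors through \<open>M\<close>, and \<open>p a = p\<close> makes the induced map
  \<open>M \<rightarrow> F\<close> a right inverse of \<open>p\<close>. Staying inside endomorphisms
  of \<open>F\<close> avoids naming that map.\<close>

lemma flat_module_presentation_splits:
  fixes X :: "'b set" and M :: "('a, 'b, 'm) module_scheme"
  assumes M: "module R M" and flat: "flat_module TYPE('a) R M"
    and J: "ideal J R" "J \<subseteq> jacobson_radical R"
    and proj: "projective_module TYPE('b set \<Rightarrow> 'a set) TYPE('b set) (R Quot J) (quotient_module R M J)"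
    and X: "finite X"
    and p: "p \<in> module_hom R (free_mod R X) M" and surj: "p ` carrier (free_mod R X) = carrier M"
  obtains a where "a \<in> module_hom R (free_mod R X) (free_mod R X)"
    "\<And>v. v \<in> carrier (free_mod R X) \<Longrightarrow> p (a v) = p v"
    "\<And>v. v \<in> carrier (free_mod R X) \<Longrightarrow> p v = \<zero>\<^bsub>M\<^esub> \<Longrightarrow> a v = \<zero>\<^bsub>free_mod R X\<^esub>"
proof -
  interpret M: module R M by fact
  let ?F = "free_mod R X" and ?e = "unit_vec R X"
  have F: "module R ?F" by (rule module_free_mod[OF M.is_cring])
  interpret F: module R ?F by (rule F)
  note [simp del] = free_mod_simps
  obtain b where b: "b \<in> module_hom R ?F ?F" and pb: "\<And>v. v \<in> carrier ?F \<Longrightarrow> p (b v) = p v"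
    and bJ: "\<And>v. v \<in> carrier ?F \<Longrightarrow> p v = \<zero>\<^bsub>M\<^esub> \<Longrightarrow> b v \<in> ideal_smult R ?F J"
    using projective_quotient_lift[OF M J(1) proj X p surj] by blast
  have bc: "b v \<in> carrier ?F" if "v \<in> carrier ?F" for v by (rule module_hom_closed[OF b that])
  define d where "d v = v \<ominus>\<^bsub>?F\<^esub> b v" for v
  have d: "d \<in> module_hom R ?F ?F"
    unfolding d_def by (rule module_hom_minus[OF F module_hom_ident b])
  have dc: "d v \<in> carrier ?F" if "v \<in> carrier ?F" for v by (rule module_hom_closed[OF d that])
  have pd: "p (d v) = \<zero>\<^bsub>M\<^esub>" if "v \<in> carrier ?F" for v
    using module_hom_diff[OF F M p that bc[OF that]] pb[OF that] module_hom_closed[OF p that]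
    by (simp add: d_def a_minus_def M.r_neg)
  \<comment> \<open>By linearity it is enough to kill \<open>d\<close> on the unit vectors, which
    together with \<open>k\<close> is a finite set of relations.\<close>
  have kill: "\<exists>a\<in>module_hom R ?F ?F. (\<forall>v\<in>carrier ?F. p (a v) = p v) \<and>
      a k = \<zero>\<^bsub>?F\<^esub> \<and> (\<forall>v\<in>carrier ?F. a (d v) = \<zero>\<^bsub>?F\<^esub>)"
    if k: "k \<in> carrier ?F" "p k = \<zero>\<^bsub>M\<^esub>" for k
  proof -
    have e: "?e x \<in> carrier ?F" for x by (rule M.unit_vec_closed)
    have Z: "finite (insert k ((\<lambda>x. d (?e x)) ` X))" "insert k ((\<lambda>x. d (?e x)) ` X) \<subseteq> carrier ?F"
      using X k(1) dc[OF e] by auto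
    have pZ: "p z = \<zero>\<^bsub>M\<^esub>" if "z \<in> insert k ((\<lambda>x. d (?e x)) ` X)" for z
      using that k(2) pd[OF e] by auto
    obtain a where a: "a \<in> module_hom R ?F ?F" "\<forall>v\<in>carrier ?F. p (a v) = p v"
      "\<forall>z\<in>insert k ((\<lambda>x. d (?e x)) ` X). a z = \<zero>\<^bsub>?F\<^esub>"
      using flat_module_kill_relations[OF M flat X p surj Z pZ] by blast
    have "a (d v) = \<zero>\<^bsub>?F\<^esub>" if v: "v \<in> carrier ?F" for v
    proof (rule M.free_mod_hom_ext[OF F X module_hom_comp[OF d a(1)] _ _ v])
      show "(\<lambda>v. \<zero>\<^bsub>?F\<^esub>) \<in> module_hom R ?F ?F" by (rule module_homI) auto
      show "a (d (?e x)) = \<zero>\<^bsub>?F\<^esub>" if "x \<in> X" for x using a(3) that by blast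
    qed
    then show ?thesis using a by (intro bexI[of _ a]) auto
  qed
  define P where "P = d ` carrier ?F"
  have P: "submodule P R ?F"
    unfolding P_def by (rule F.submodule_image[OF F d F.carrier_is_submodule])
  have relP: "k \<in> P" if k: "k \<in> carrier ?F" "p k = \<zero>\<^bsub>M\<^esub>" for k
  proof -
    obtain a where a: "a \<in> module_hom R ?F ?F" and pa: "\<And>v. v \<in> carrier ?F \<Longrightarrow> p (a v) = p v"
      and ak: "a k = \<zero>\<^bsub>?F\<^esub>" and ad: "\<And>v. v \<in> carrier ?F \<Longrightarrow> a (d v) = \<zero>\<^bsub>?F\<^esub>"
      using kill[OF k] by blast
    have ac: "a v \<in> carrier ?F" if "v \<in> carrier ?F" for v by (rule module_hom_closed[OF a that])
    have ab: "a (b v) = a v" if v: "v \<in> carrier ?F" for v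
    proof -
      have "a v \<ominus>\<^bsub>?F\<^esub> a (b v) = \<zero>\<^bsub>?F\<^esub>"
        using module_hom_diff[OF F F a v bc[OF v]] ad[OF v] by (simp add: d_def)
      then show ?thesis using F.minus_eq_zeroD[OF ac[OF v] ac[OF bc[OF v]]] by metis
    qed
    define f where "f v = b v \<ominus>\<^bsub>?F\<^esub> a v" for v
    have f: "f \<in> module_hom R ?F ?F" unfolding f_def by (rule module_hom_minus[OF F b a])
    have fc: "f v \<in> carrier ?F" if "v \<in> carrier ?F" for v by (rule module_hom_closed[OF f that])
    have pf: "p (f v) = \<zero>\<^bsub>M\<^esub>" if v: "v \<in> carrier ?F" for v
      using module_hom_diff[OF F M p bc[OF v] ac[OF v]] pa[OF v] pb[OF v] module_hom_closed[OF p v]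
      by (simp add: f_def a_minus_def M.r_neg)
    \<comment> \<open>Here \<open>f v\<close> is a relation, so \<open>b (f v)\<close> lies in
      \<open>J F\<close>. From \<open>a = a b\<close> also \<open>a (f v) = a (b (f v))\<close>,
      which stays in \<open>J F\<close> by linearity of \<open>a\<close>.\<close>
    have fJ: "f (f v) \<in> ideal_smult R ?F J" if v: "v \<in> carrier ?F" for v
    proof -
      let ?w = "b (f v)"
      let ?J = "ideal_smult R ?F J"
      have J': "submodule ?J R ?F" by (rule F.ideal_smult_submodule[OF J(1)])
      have w: "?w \<in> ?J" by (rule bJ[OF fc[OF v] pf[OF v]])
      interpret J: ideal J R by (rule J(1))
      have "?J \<subseteq> {v \<in> carrier ?F. a v \<in> ?J}"
      proof (rule F.ideal_smult_subset[OF F.submodule_vimage[OF F a J']])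
        fix r u assume r: "r \<in> J" and u: "u \<in> carrier ?F"
        then show "r \<odot>\<^bsub>?F\<^esub> u \<in> {v \<in> carrier ?F. a v \<in> ?J}"
          using module_hom_smult[OF a J.a_Hcarr u] F.ideal_smult_mem[OF r ac[OF u]] J.a_Hcarr by simp
      qed
      then have "a ?w \<in> ?J" using w by blast
      then have "?w \<ominus>\<^bsub>?F\<^esub> a ?w \<in> ?J" by (rule F.submodule_diff_closed[OF J' w])
      then show ?thesis using ab[OF fc[OF v]] by (simp add: f_def)
    qed
    \<comment> \<open>On \<open>P\<close> the term \<open>a\<close> disappears, and \<open>b\<close>
      commutes with \<open>d = 1 - b\<close>.\<close>
    have fP: "f x \<in> P" if "x \<in> P" for x
    proof -
      obtain v where v: "v \<in> carrier ?F" "x = d v" using \<open>x \<in> P\<close> unfolding P_def by blast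
      have "f x = b (d v) \<ominus>\<^bsub>?F\<^esub> \<zero>\<^bsub>?F\<^esub>" using ad[OF v(1)] v(2) by (simp add: f_def)
      also have "\<dots> = b v \<ominus>\<^bsub>?F\<^esub> b (b v)"
        using module_hom_diff[OF F F b v(1) bc[OF v(1)]] bc[OF v(1)] bc[OF bc[OF v(1)]]
        by (simp add: d_def a_minus_def)
      finally show ?thesis unfolding P_def using bc[OF v(1)] by (auto simp: d_def)
    qed
    have kf: "k \<ominus>\<^bsub>?F\<^esub> f k \<in> P"
    proof -
      have z: "\<ominus>\<^bsub>?F\<^esub> \<zero>\<^bsub>?F\<^esub> = \<zero>\<^bsub>?F\<^esub>" using F.r_neg[OF F.zero_closed] by simp
      have "f k = b k" unfolding f_def ak a_minus_def z by (rule F.r_zero[OF bc[OF k(1)]])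
      then have "k \<ominus>\<^bsub>?F\<^esub> f k = d k" by (simp add: d_def)
      then show ?thesis using k(1) by (simp add: P_def)
    qed
    moreover have "f k \<ominus>\<^bsub>?F\<^esub> f (f k) \<in> P"
      using fP[OF kf] module_hom_diff[OF F F f k(1) fc[OF k(1)]] by simp
    ultimately have "(k \<ominus>\<^bsub>?F\<^esub> f k) \<oplus>\<^bsub>?F\<^esub> (f k \<ominus>\<^bsub>?F\<^esub> f (f k)) \<in> P" by (rule F.submoduleE(5)[OF P])
    moreover have "(k \<ominus>\<^bsub>?F\<^esub> f k) \<oplus>\<^bsub>?F\<^esub> (f k \<ominus>\<^bsub>?F\<^esub> f (f k)) = k \<ominus>\<^bsub>?F\<^esub> f (f k)"
      using k(1) fc[OF k(1)] fc[OF fc[OF k(1)]] by (simp add: a_minus_def F.a_assoc F.r_neg1)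
    ultimately have kff: "k \<ominus>\<^bsub>?F\<^esub> f (f k) \<in> P" by simp
    show "k \<in> P"
    proof (rule F.nakayama_fixed_point[OF module_hom_comp[OF f f] J fJ _ _ M.module_span_unit_vec[OF X] P _ k(1) kff])
      show "?e ` X \<subseteq> carrier ?F" using M.unit_vec_closed by (rule image_subsetI)
    qed (use X fP in auto)
  qed
  \<comment> \<open>Every relation now lies in \<open>P\<close>, so an \<open>a\<close> that kills
    \<open>P\<close> is enough and the extra relation can be taken to be zero.\<close>
  obtain a where a: "a \<in> module_hom R ?F ?F" "\<And>v. v \<in> carrier ?F \<Longrightarrow> p (a v) = p v"
    and ad: "\<And>v. v \<in> carrier ?F \<Longrightarrow> a (d v) = \<zero>\<^bsub>?F\<^esub>"
    using kill[OF F.zero_closed module_hom_zero[OF F M p]] by blast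
  have az: "a v = \<zero>\<^bsub>?F\<^esub>" if "v \<in> carrier ?F" "p v = \<zero>\<^bsub>M\<^esub>" for v
    using relP[OF that] ad by (auto simp: P_def)
  show ?thesis by (rule that[OF a az])
qed

(* The types in the hypotheses are the smallest natural ones at which flatness of M and
   projectivity of M/JM have full strength, so these hypotheses are implied by their versions
   at larger types; the conclusion holds for arbitrary types 'c and 'd of test modules. *)
theorem theorem3p2:
  fixes R :: "('a, 'r) ring_scheme"
    and M :: "('a, 'b, 'm) module_scheme"
    and J :: "'a set"
  assumes "cring R"
    and "module R M"
    and "finitely_generated_module R M"
    and "flat_module TYPE('a) R M"
    and "ideal J R"
    and "J \<subseteq> jacobson_radical R"
    and "projective_module TYPE('b set \<Rightarrow> 'a set) TYPE('b set) (R Quot J) (quotient_module R M J)"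
  shows "projective_module TYPE('c) TYPE('d) R M"
proof -
  note M = \<open>module R M\<close>
  interpret M: module R M by fact
  obtain X where X: "finite X" "X \<subseteq> carrier M" "module_span R M X = carrier M"
    using assms(3) unfolding finitely_generated_module_def by blast
  let ?F = "free_mod R X" and ?e = "unit_vec R X"
  have F: "module R ?F" by (rule module_free_mod[OF assms(1)])
  interpret F: module R ?F by (rule F)
  note [simp del] = free_mod_simps
  define p where "p = lincomb M X (\<lambda>x. x)"
  have Xm: "(\<lambda>x. x) \<in> X \<rightarrow> carrier M" using X(2) by auto
  have p: "p \<in> module_hom R ?F M" unfolding p_def by (rule M.lincomb_hom[OF M Xm])
  have pe: "p (?e x) = x" if "x \<in> X" for x
    unfolding p_def by (rule M.lincomb_of_unit_vec[OF M X(1) Xm that])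
  have surj: "p ` carrier ?F = carrier M"
  proof
    show "p ` carrier ?F \<subseteq> carrier M" using module_hom_closed[OF p] by blast
    have "X \<subseteq> p ` carrier ?F" using pe[symmetric] M.unit_vec_closed by (intro subsetI) (rule image_eqI)
    then have "module_span R M X \<subseteq> p ` carrier ?F"
      by (rule M.module_span_subset[OF F.submodule_image[OF M p F.carrier_is_submodule]])
    then show "carrier M \<subseteq> p ` carrier ?F" using X(3) by simp
  qed
  obtain a where a: "a \<in> module_hom R ?F ?F" and pa: "\<And>v. v \<in> carrier ?F \<Longrightarrow> p (a v) = p v"
    and az: "\<And>v. v \<in> carrier ?F \<Longrightarrow> p v = \<zero>\<^bsub>M\<^esub> \<Longrightarrow> a v = \<zero>\<^bsub>?F\<^esub>"
    using flat_module_presentation_splits[OF M assms(4-7) X(1) p surj] by blast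
  \<comment> \<open>Constancy on the fibres of \<open>p\<close>: this is the factorisation of
    \<open>a\<close> through \<open>M\<close>.\<close>
  have a_cong: "a u = a v" if uv: "u \<in> carrier ?F" "v \<in> carrier ?F" "p u = p v" for u v
  proof -
    have "p (u \<ominus>\<^bsub>?F\<^esub> v) = \<zero>\<^bsub>M\<^esub>"
      using module_hom_diff[OF F M p uv(1,2)] uv(3) module_hom_closed[OF p uv(2)]
      by (simp add: a_minus_def M.r_neg)
    then have "a u \<ominus>\<^bsub>?F\<^esub> a v = \<zero>\<^bsub>?F\<^esub>"
      using az[OF F.minus_closed[OF uv(1,2)]] module_hom_diff[OF F F a uv(1,2)] by simp
    then show ?thesis
      using F.minus_eq_zeroD[OF module_hom_closed[OF a uv(1)] module_hom_closed[OF a uv(2)]] by simp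
  qed
  show ?thesis
    unfolding projective_module_def
  proof (intro allI impI)
    fix N :: "('a, 'c) module" and N' :: "('a, 'd) module" and g f
    assume N: "module R N" and N': "module R N'" and g: "g \<in> module_hom R N N'"
      and gs: "g ` carrier N = carrier N'" and f: "f \<in> module_hom R M N'"
    have "\<exists>y\<in>carrier N. g y = f x" if "x \<in> X" for x
    proof -
      have "f x \<in> g ` carrier N" using module_hom_closed[OF f] X(2) that gs by auto
      then show ?thesis by (elim imageE) auto
    qed
    then obtain n where n: "\<And>x. x \<in> X \<Longrightarrow> n x \<in> carrier N" "\<And>x. x \<in> X \<Longrightarrow> g (n x) = f x" by metis
    have nX: "n \<in> X \<rightarrow> carrier N" using n(1) by auto
    \<comment> \<open>A lift of \<open>f p\<close> along \<open>g\<close>, obtained by choosing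
      preimages on the basis.\<close>
    define l where "l = lincomb N X n"
    have l: "l \<in> module_hom R ?F N" unfolding l_def by (rule M.lincomb_hom[OF N nX])
    have gl: "g (l v) = f (p v)" if "v \<in> carrier ?F" for v
      by (rule M.free_mod_hom_ext[OF N' X(1) module_hom_comp[OF l g] module_hom_comp[OF p f] _ that])
        (use M.lincomb_of_unit_vec[OF N X(1) nX] n(2) pe in \<open>simp add: l_def\<close>)
    have "\<exists>v\<in>carrier ?F. p v = m" if "m \<in> carrier M" for m
    proof -
      have "m \<in> p ` carrier ?F" using surj that by simp
      then show ?thesis by (elim imageE) auto
    qed
    \<comment> \<open>\<open>s\<close> is only a set-theoretic section and need not be linear. The
      composite \<open>la s\<close> is linear all the same, because \<open>la = l a\<close> depends
      on a vector only through its image under \<open>p\<close>, so \<open>s (x + y)\<close> may be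
      replaced by \<open>s x + s y\<close>.\<close>
    then obtain s where s: "\<And>m. m \<in> carrier M \<Longrightarrow> s m \<in> carrier ?F" "\<And>m. m \<in> carrier M \<Longrightarrow> p (s m) = m"
      by metis
    define la where "la v = l (a v)" for v
    have la: "la \<in> module_hom R ?F N" unfolding la_def by (rule module_hom_comp[OF a l])
    have la_s: "la (s m) = la v" if "m \<in> carrier M" "v \<in> carrier ?F" "p v = m" for m v
      unfolding la_def using a_cong[OF s(1)[OF that(1)] that(2)] s(2) that by simp
    show "\<exists>h\<in>module_hom R M N. \<forall>x\<in>carrier M. g (h x) = f x"
    proof (intro bexI ballI)
      show "(\<lambda>m. la (s m)) \<in> module_hom R M N"
      proof (rule module_homI)
        fix x y assume x: "x \<in> carrier M" and y: "y \<in> carrier M"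
        show "la (s x) \<in> carrier N" by (rule module_hom_closed[OF la s(1)[OF x]])
        have "la (s (x \<oplus>\<^bsub>M\<^esub> y)) = la (s x \<oplus>\<^bsub>?F\<^esub> s y)"
          using x y s by (intro la_s) (simp_all add: module_hom_add[OF p])
        then show "la (s (x \<oplus>\<^bsub>M\<^esub> y)) = la (s x) \<oplus>\<^bsub>N\<^esub> la (s y)"
          using module_hom_add[OF la s(1)[OF x] s(1)[OF y]] by simp
      next
        fix r x assume r: "r \<in> carrier R" and x: "x \<in> carrier M"
        have "la (s (r \<odot>\<^bsub>M\<^esub> x)) = la (r \<odot>\<^bsub>?F\<^esub> s x)"
          using r x s by (intro la_s) (simp_all add: module_hom_smult[OF p])
        then show "la (s (r \<odot>\<^bsub>M\<^esub> x)) = r \<odot>\<^bsub>N\<^esub> la (s x)"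
          using module_hom_smult[OF la r s(1)[OF x]] by simp
      qed
      show "g (la (s x)) = f x" if "x \<in> carrier M" for x
        unfolding la_def using gl[OF module_hom_closed[OF a s(1)[OF that]]] pa s that by simp
    qed
  qed
qed

end
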